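(* The functional $F\mapsto E_\phi[F]:=\inf_{\mu\in M(F)}E_\phi(\mu)$ is upper semicontinuous on $\mathbb F$ equipped with the Hausdorff metric.
   Context: Let $\mathbb H=\{z:\operatorname{Im}z>0\}$ and $\bar{\mathbb H}=\{z:\operatorname{Im}z\ge0\}\cup\{\infty\}$, viewed in the Riemann sphere. Fix $A>0$ and let $\mathbb K=\mathbb H\setminus\{z:\operatorname{Re}z=0,\ 0<\operatorname{Im}z\le A\}$. In the closure $\bar{\mathbb K}$ the two sides of the slit are distinguished: for $0\le s<A$ the points $is_+$, $is_-$ are distinct; $\infty\in\bar{\mathbb K}$. $\bar{\mathbb K}$ carries the chordal distance $d_0$ (with the two slit sides distinct). $\mathbb F$ is the set of all continua (compact connected sets) in $\bar{\mathbb K}$ containing $0_+$ and $0_-$, with the Hausdorff metric $d(A,B)=\max\big(\max_{a\in A}\min_{b\in B}d_0(a,b),\ \max_{b\in B}\min_{a\in A}d_0(a,b)\big)$. Let $\rho^0$ be holomorphic in $\mathbb H$, continuous on $\{\operatorname{Im}z\ge0\}$, with $\operatorname{Re}\rho^0=0$ on $[0,iA]$ and $\operatorname{Im}\rho^0>0$ on $(0,iA]\cup\mathbb R$. Let $G(z,\eta)=\log\frac{|z-\bar\eta|}{|z-\eta|}$, $d\mu^0(\eta)=-\rho^0(\eta)d\eta$ on $[0,iA]$ oriented from $0$ to $iA$, and for parameters $x\ge0,t\ge0$ $$\phi(z)=-\int G(z,\eta)\,d\mu^0(\eta)-\operatorname{Re}\Big[i\pi\int_z^{iA}\rho^0(\eta)\,d\eta+2i(zx+z^2t)\Big].$$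 $\mathbb M$ is the set of positive Borel measures on $\bar{\mathbb K}$ with finite Green energy $E(\mu)=\iint G\,d\mu\,d\mu$ and finite $\int\phi\,d\mu$; $E_\phi(\mu)=E(\mu)+2\int\phi\,d\mu$; $M(F)$ is the set of measures in $\mathbb M$ supported in $F$. *)

theory Defs
  imports "HOL-Analysis.Analysis" "HOL-Complex_Analysis.Complex_Analysis"
begin

text \<open>A point of the closure of K (with the two sides of the slit distinguished).
  KInf is the point at infinity. KPt z b is the finite point z; the flag b is only
  meaningful on the slit {i s : 0 \<le> s < A}: KPt (i s) False is the right side
  i s_+ (approached from Re z > 0), KPt (i s) True is the left side i s_-.
  For all other points the flag is fixed to False.\<close>

datatype kpt = KInf | KPt complex bool

definition on_slit :: "real \<Rightarrow> complex \<Rightarrow> bool" where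
  "on_slit A z \<longleftrightarrow> Re z = 0 \<and> 0 \<le> Im z \<and> Im z < A"

definition Kbar :: "real \<Rightarrow> kpt set" where
  "Kbar A = {KInf} \<union> {KPt z False | z. 0 \<le> Im z} \<union> {KPt z True | z. on_slit A z}"

fun zof :: "kpt \<Rightarrow> complex option" where
  "zof KInf = None"
| "zof (KPt z b) = Some z"

definition chord :: "complex option \<Rightarrow> complex option \<Rightarrow> real" where
  "chord p q = (case (p, q) of
      (None, None) \<Rightarrow> 0
    | (Some z, None) \<Rightarrow> 2 / sqrt (1 + (cmod z)\<^sup>2)
    | (None, Some w) \<Rightarrow> 2 / sqrt (1 + (cmod w)\<^sup>2)
    | (Some z, Some w) \<Rightarrow> 2 * cmod (z - w) / sqrt ((1 + (cmod z)\<^sup>2) * (1 + (cmod w)\<^sup>2)))"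

text \<open>Uniformizing coordinate w = sqrt(z^2 + A^2) (branch with Im w > 0 on K),
  extended to the closure; it maps the closure of K (slit sides distinct)
  homeomorphically onto the closed upper half plane plus infinity.
  Right side of the slit / positive reals go to w \<ge> 0, left side / negative reals to w \<le> 0.\<close>
fun wof :: "real \<Rightarrow> kpt \<Rightarrow> complex option" where
  "wof A KInf = None"
| "wof A (KPt z b) =
     (let u = z\<^sup>2 + complex_of_real (A\<^sup>2);
          right = (if Re z = 0 then \<not> b else 0 < Re z)
      in Some (if Im u = 0 \<and> 0 \<le> Re u
               then (if right then complex_of_real (sqrt (Re u)) else - complex_of_real (sqrt (Re u)))
               else \<i> * csqrt (- u)))"

text \<open>The distance d0 on the closure of K: chordal distance of the z-coordinates,
  made to separate the two sides of the slit by also taking into account the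
  chordal distance of the uniformizing coordinates.\<close>
definition d0 :: "real \<Rightarrow> kpt \<Rightarrow> kpt \<Rightarrow> real" where
  "d0 A p q = max (chord (zof p) (zof q)) (chord (wof A p) (wof A q))"

definition Ktop :: "real \<Rightarrow> kpt topology" where
  "Ktop A = Metric_space.mtopology (Kbar A) (d0 A)"

definition FF :: "real \<Rightarrow> kpt set set" where
  "FF A = {F. F \<subseteq> Kbar A \<and> F \<noteq> {} \<and> compactin (Ktop A) F \<and> connectedin (Ktop A) F
              \<and> KPt 0 False \<in> F \<and> KPt 0 True \<in> F}"

definition hausd :: "real \<Rightarrow> kpt set \<Rightarrow> kpt set \<Rightarrow> real" where
  "hausd A F1 F2 = max (SUP a\<in>F1. INF b\<in>F2. d0 A a b) (SUP b\<in>F2. INF a\<in>F1. d0 A a b)"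

definition Gc :: "complex \<Rightarrow> complex \<Rightarrow> ennreal" where
  "Gc z \<eta> = (if z = \<eta> then (if 0 < Im z then \<infinity> else 0)
             else ennreal (ln (cmod (z - cnj \<eta>) / cmod (z - \<eta>))))"

definition Gk :: "kpt \<Rightarrow> kpt \<Rightarrow> ennreal" where
  "Gk p q = (case (zof p, zof q) of (Some z, Some \<eta>) \<Rightarrow> Gc z \<eta> | _ \<Rightarrow> 0)"

text \<open>Real-valued Green function used inside the (Lebesgue-null) line integral.\<close>
definition Gr :: "complex \<Rightarrow> complex \<Rightarrow> real" where
  "Gr z \<eta> = ln (cmod (z - cnj \<eta>) / cmod (z - \<eta>))"

text \<open>phi(z) = - int G(z,eta) d mu0(eta) - Re[ i pi int_z^{iA} rho0 + 2 i (z x + z^2 t) ],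
  with d mu0 = - rho0(eta) d eta on [0, iA] oriented from 0 to iA; the path integral
  int_z^{iA} rho0 is taken along the segment (path independent by Cauchy).\<close>
definition phi :: "real \<Rightarrow> (complex \<Rightarrow> complex) \<Rightarrow> real \<Rightarrow> real \<Rightarrow> complex \<Rightarrow> real" where
  "phi A \<rho>0 x t z =
     - Re (contour_integral (linepath 0 (\<i> * complex_of_real A))
             (\<lambda>\<eta>. complex_of_real (Gr z \<eta>) * (- \<rho>0 \<eta>)))
     - Re (\<i> * complex_of_real pi * contour_integral (linepath z (\<i> * complex_of_real A)) \<rho>0
           + 2 * \<i> * (z * complex_of_real x + z\<^sup>2 * complex_of_real t))"

definition phik :: "real \<Rightarrow> (complex \<Rightarrow> complex) \<Rightarrow> real \<Rightarrow> real \<Rightarrow> kpt \<Rightarrow> real" where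
  "phik A \<rho>0 x t p = (case zof p of None \<Rightarrow> 0 | Some z \<Rightarrow> phi A \<rho>0 x t z)"

definition Kborel :: "real \<Rightarrow> kpt measure" where
  "Kborel A = sigma (Kbar A) {U. openin (Ktop A) U}"

definition energy :: "kpt measure \<Rightarrow> ennreal" where
  "energy \<mu> = (\<integral>\<^sup>+ p. (\<integral>\<^sup>+ q. Gk p q \<partial>\<mu>) \<partial>\<mu>)"

definition MM :: "real \<Rightarrow> (complex \<Rightarrow> complex) \<Rightarrow> real \<Rightarrow> real \<Rightarrow> kpt measure set" where
  "MM A \<rho>0 x t = {\<mu>. sets \<mu> = sets (Kborel A) \<and> energy \<mu> < \<infinity>
                       \<and> integrable \<mu> (phik A \<rho>0 x t)}"

definition Ephi :: "real \<Rightarrow> (complex \<Rightarrow> complex) \<Rightarrow> real \<Rightarrow> real \<Rightarrow> kpt measure \<Rightarrow> real" where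
  "Ephi A \<rho>0 x t \<mu> = enn2real (energy \<mu>) + 2 * (\<integral> p. phik A \<rho>0 x t p \<partial>\<mu>)"

definition MF :: "real \<Rightarrow> (complex \<Rightarrow> complex) \<Rightarrow> real \<Rightarrow> real \<Rightarrow> kpt set \<Rightarrow> kpt measure set" where
  "MF A \<rho>0 x t F = {\<mu> \<in> MM A \<rho>0 x t. emeasure \<mu> (Kbar A - F) = 0}"

definition EphiF :: "real \<Rightarrow> (complex \<Rightarrow> complex) \<Rightarrow> real \<Rightarrow> real \<Rightarrow> kpt set \<Rightarrow> ereal" where
  "EphiF A \<rho>0 x t F = (INF \<mu>\<in>MF A \<rho>0 x t F. ereal (Ephi A \<rho>0 x t \<mu>))"

end

theory Submission
  imports Defs
begin

text \<open>
  Let \<open>\<mu>\<close> be a competitor on \<open>F0\<close> with \<open>E_phi(\<mu>) < c\<close>; a competitor on a nearby continuum \<open>F\<close> is obtained by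
  moving \<open>\<mu>\<close> a little. Since \<open>F\<close> is connected and contains 0 and a point near any given \<open>b\<close> in
  the support of \<open>\<mu>\<close>, every small distance \<open>\<rho>\<close> from \<open>b\<close> is attained on \<open>F\<close>, and a point of \<open>F\<close> at
  distance \<open>\<rho>\<close> can be chosen as a Borel function of \<open>\<rho>\<close>. Two points at distances \<open>\<rho>\<close>, \<open>\<rho>'\<close> from \<open>b\<close> are at
  least \<open>|\<rho> - \<rho>'|\<close> apart, so the image of the uniform distribution on \<open>[r, 2 r]\<close> has logarithmic
  potential at most \<open>log (1 / r) + const\<close>. Replacing \<open>\<mu>\<close> cell by cell with such measures
  changes the Green kernel only by a factor and a constant that are close to 1 and 0: pairs at distance much
  larger than \<open>r\<close> see a small relative change, and for the others the additive constant is negligible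
  against \<open>log (1 / r)\<close>. The field is continuous on the closed half-plane, so its integral changes little.

  This needs the support of \<open>\<mu>\<close> to be compact in the open half-plane. On the negative reals and at
  infinity the field is nonnegative and the Green function vanishes, so cutting off there is
  harmless. On the positive reals the field is negative; if \<open>F0\<close> contains such a point, then \<open>F0\<close> has
  energy \<open>-\<infinity>\<close>, and measures on \<open>F\<close> spread uniformly over the logarithm of the distance to that point have
  Green energy tending to 0, hence the energy of \<open>F\<close> tends to \<open>-\<infinity>\<close>.
\<close>

section \<open>The closure of the slit half-plane as a metric space\<close>

text \<open>Stereographic projection onto the unit sphere of \<open>complex \<times> real\<close>,
  with infinity at the north pole. It turns the chordal distance into a Euclidean one, which then
  inherits the metric axioms.\<close>

definition stereo :: "complex option \<Rightarrow> complex \<times> real" where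
  "stereo p = (case p of None \<Rightarrow> (0, 1)
     | Some z \<Rightarrow> (of_real (2 / (1 + (cmod z)\<^sup>2)) * z, ((cmod z)\<^sup>2 - 1) / (1 + (cmod z)\<^sup>2)))"

lemma chord_eq_dist: "chord p q = dist (stereo p) (stereo q)"
proof -
  have one: "1 + (cmod z)\<^sup>2 > 0" for z by (simp add: add_pos_nonneg)
  have N: "2 / sqrt (1 + (cmod z)\<^sup>2) = dist (stereo (Some z)) (stereo None)" for z
  proof -
    define n where "n = (cmod z)\<^sup>2"
    have n: "1 + n > 0" "n \<ge> 0" using one[of z] by (auto simp: n_def)
    have nn: "0 \<le> 4 * n / (1 + n)\<^sup>2 + ((n - 1) / (1 + n) - 1)\<^sup>2" using n by simp
    have "(dist (stereo (Some z)) (stereo None))\<^sup>2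
        = (2 / (1 + n))\<^sup>2 * n + ((n - 1) / (1 + n) - 1)\<^sup>2"
      using nn by (simp add: stereo_def dist_norm norm_Pair norm_mult norm_divide n_def[symmetric] power_mult_distrib power_divide
         del: of_real_divide of_real_add)
    also have "\<dots> = 4 / (1 + n)"
      using n by (simp add: divide_simps power2_eq_square)
    also have "\<dots> = (2 / sqrt (1 + n))\<^sup>2" using n by (simp add: power_divide)
    finally show ?thesis using n by (simp add: n_def)
  qed
  have S: "2 * cmod (z - w) / sqrt ((1 + (cmod z)\<^sup>2) * (1 + (cmod w)\<^sup>2))
      = dist (stereo (Some z)) (stereo (Some w))" for z w
  proof -
    obtain a b where z: "z = Complex a b" by (cases z)
    obtain c d where w: "w = Complex c d" by (cases w)
    define n where "n = 1 + (a\<^sup>2 + b\<^sup>2)"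
    define m where "m = 1 + (c\<^sup>2 + d\<^sup>2)"
    have n: "n > 0" "m > 0" by (auto simp: n_def m_def add_pos_nonneg)
    have "(dist (stereo (Some z)) (stereo (Some w)))\<^sup>2
        = (2 / n * a - 2 / m * c)\<^sup>2 + (2 / n * b - 2 / m * d)\<^sup>2 + ((n - 2) / n - (m - 2) / m)\<^sup>2"
      unfolding stereo_def option.case dist_Pair_Pair
      by (simp add: dist_norm cmod_power2 z w n_def m_def del: of_real_divide of_real_add)
    also have "\<dots> = 4 * ((a - c)\<^sup>2 + (b - d)\<^sup>2) / (n * m)"
    proof -
      have "(2 / n * a - 2 / m * c)\<^sup>2 + (2 / n * b - 2 / m * d)\<^sup>2 + ((n - 2) / n - (m - 2) / m)\<^sup>2
         = 4 * ((m * a - n * c)\<^sup>2 + (m * b - n * d)\<^sup>2 + (n - m)\<^sup>2) / (n * m)\<^sup>2"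
        using n by (simp add: divide_simps power2_eq_square) (simp add: algebra_simps)
      \<comment> \<open>Only here do the definitions of \<open>n\<close> and \<open>m\<close>
        matter: expanding the squares with them produces the factor \<open>n * m\<close>, which
        cancels against the denominator.\<close>
      also have "(m * a - n * c)\<^sup>2 + (m * b - n * d)\<^sup>2 + (n - m)\<^sup>2 = (n * m) * ((a - c)\<^sup>2 + (b - d)\<^sup>2)"
        unfolding n_def m_def by algebra
      finally show ?thesis using n by (simp add: power2_eq_square)
    qed
    also have "\<dots> = (2 * cmod (z - w) / sqrt (n * m))\<^sup>2"
      using n by (simp add: power_divide power_mult_distrib cmod_power2 z w)
    finally have "dist (stereo (Some z)) (stereo (Some w)) = 2 * cmod (z - w) / sqrt (n * m)"
      using n by simp
    thus ?thesis by (simp add: n_def m_def cmod_power2 z w)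
  qed
  show ?thesis
    using N S by (auto simp: chord_def dist_commute split: option.splits)
qed

lemma chord_commute: "chord p q = chord q p"
  by (simp add: chord_eq_dist dist_commute)

lemma chord_triangle: "chord p r \<le> chord p q + chord q r"
  by (simp add: chord_eq_dist dist_triangle)

lemma chord_ge_0 [simp]: "0 \<le> chord p q"
  by (simp add: chord_eq_dist)

lemma chord_self [simp]: "chord p p = 0"
  by (simp add: chord_eq_dist)

lemma one_plus_norm_sq_pos: "0 < 1 + (cmod z)\<^sup>2"
  by (simp add: add_pos_nonneg)

lemma chord_eq_0_iff: "chord p q = 0 \<longleftrightarrow> p = q"
proof
  assume *: "chord p q = 0"
  show "p = q"
    using * one_plus_norm_sq_pos by (cases p; cases q) (auto simp: chord_def less_le)
qed simp

lemma stereo_inj: "stereo p = stereo q \<longleftrightarrow> p = q"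
  using chord_eq_0_iff[of p q] by (simp add: chord_eq_dist)

lemma norm_stereo: "norm (stereo p) = 1"
proof (cases p)
  case (Some z)
  have p: "1 + (cmod z)\<^sup>2 > 0" by (rule one_plus_norm_sq_pos)
  have "(norm (stereo p))\<^sup>2 = 1"
    using p by (simp add: Some stereo_def norm_prod_def norm_mult power_mult_distrib norm_divide power_divide
       del: of_real_divide of_real_add) (simp add: divide_simps power2_eq_square, simp add: algebra_simps)
  thus ?thesis by (simp add: power2_eq_1_iff) (smt (verit) norm_ge_zero)
qed (simp add: stereo_def norm_prod_def)

lemma chord_le_2: "chord p q \<le> 2"
  using norm_triangle_ineq4[of "stereo p" "stereo q"] by (simp add: chord_eq_dist dist_norm norm_stereo)

lemma d0_le_2: "d0 A p q \<le> 2"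
  by (simp add: d0_def chord_le_2)

lemma d0_ge_0: "0 \<le> d0 A p q"
  by (simp add: d0_def le_max_iff_disj)

text \<open>On the slit below its tip \<open>z\<^sup>2 + A\<^sup>2\<close> is real and strictly
  positive, and the two sides receive its square roots of opposite sign.\<close>

lemma wof_slit_sides:
  assumes "on_slit A z"
  shows "wof A (KPt z False) \<noteq> wof A (KPt z True)"
proof -
  obtain a b where z: "z = Complex a b" by (cases z)
  have "b\<^sup>2 < A\<^sup>2" using assms by (auto simp: on_slit_def z power_strict_mono)
  thus ?thesis using assms by (auto simp: on_slit_def z Let_def power2_eq_square complex_eq_iff)
qed

lemma Kbar_cases:
  assumes "p \<in> Kbar A"
  obtains "p = KInf" | z b where "p = KPt z b" "0 \<le> Im z" "b \<Longrightarrow> on_slit A z"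
  using assms by (auto simp: Kbar_def on_slit_def)

text \<open>Embedding of the closure into a Euclidean space. The first component alone would
  identify the two sides of the slit. The map is injective on \<open>Kbar A\<close> and Lipschitz
  for \<open>d0\<close>, so compactness, connectedness and Borel questions can be moved to its
  image.\<close>

definition kemb :: "real \<Rightarrow> kpt \<Rightarrow> (complex \<times> real) \<times> (complex \<times> real)" where
  "kemb A p = (stereo (zof p), stereo (wof A p))"

lemma kemb_inj_on: "inj_on (kemb A) (Kbar A)"
proof (rule inj_onI)
  fix p q assume p: "p \<in> Kbar A" and q: "q \<in> Kbar A" and eq: "kemb A p = kemb A q"
  have eq: "zof p = zof q" "wof A p = wof A q" using eq by (auto simp: kemb_def stereo_inj)
  from p show "p = q"
  proof (cases rule: Kbar_cases)
    case 1 thus ?thesis using eq by (cases q) auto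
  next
    case (2 z b)
    note p2 = 2
    from q show ?thesis
    proof (cases rule: Kbar_cases)
      case 1 thus ?thesis using eq p2 by auto
    next
      case (2 z' b')
      have "z' = z" using eq 2 p2 by simp
      thus ?thesis using wof_slit_sides[of A z] eq 2 p2 by (cases b; cases b') auto
    qed
  qed
qed

lemma dist_kemb_le: "dist (kemb A p) (kemb A q) \<le> 2 * d0 A p q"
proof -
  have "dist (kemb A p) (kemb A q) \<le> chord (zof p) (zof q) + chord (wof A p) (wof A q)"
    by (simp add: kemb_def dist_Pair_Pair chord_eq_dist sqrt_sum_squares_le_sum)
  thus ?thesis by (simp add: d0_def)
qed

lemma Metric_space_Kbar: "Metric_space (Kbar A) (d0 A)"
proof
  fix p q r
  show "0 \<le> d0 A p q" by (rule d0_ge_0)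
  show "d0 A p q = d0 A q p" by (simp add: d0_def chord_commute)
  show "d0 A p q = 0 \<longleftrightarrow> p = q" if "p \<in> Kbar A" "q \<in> Kbar A"
  proof
    assume "d0 A p q = 0"
    hence "kemb A p = kemb A q" using dist_kemb_le[of A p q] by simp
    thus "p = q" using kemb_inj_on that by (auto dest: inj_onD)
  qed (simp add: d0_def)
  show "d0 A p r \<le> d0 A p q + d0 A q r"
    using chord_triangle[of "zof p" "zof r" "zof q"] chord_triangle[of "wof A p" "wof A r" "wof A q"]
    by (auto simp: d0_def)
qed

lemma topspace_Ktop [simp]: "topspace (Ktop A) = Kbar A"
  unfolding Ktop_def by (rule Metric_space.topspace_mtopology[OF Metric_space_Kbar])

lemma Hausdorff_Ktop: "Hausdorff_space (Ktop A)"
  unfolding Ktop_def by (rule Metric_space.Hausdorff_space_mtopology[OF Metric_space_Kbar])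

lemma continuous_map_kemb: "continuous_map (Ktop A) euclidean (kemb A)"
  unfolding continuous_map_def
proof (intro conjI allI impI)
  interpret Metric_space "Kbar A" "d0 A" by (rule Metric_space_Kbar)
  fix U :: "((complex \<times> real) \<times> (complex \<times> real)) set" assume "openin euclidean U"
  hence U: "open U" by simp
  show "openin (Ktop A) {p \<in> topspace (Ktop A). kemb A p \<in> U}"
    unfolding topspace_Ktop unfolding Ktop_def openin_mtopology
  proof (intro conjI allI impI)
    fix p assume "p \<in> {p \<in> Kbar A. kemb A p \<in> U}"
    then obtain e where e: "e > 0" "\<And>y. dist y (kemb A p) < e \<Longrightarrow> y \<in> U"
      using U unfolding open_dist by blast
    show "\<exists>r>0. mball p r \<subseteq> {p \<in> Kbar A. kemb A p \<in> U}"
    proof (intro exI conjI subsetI)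
      fix q assume "q \<in> mball p (e/2)"
      hence q: "q \<in> Kbar A" "d0 A p q < e/2" by auto
      thus "q \<in> {p \<in> Kbar A. kemb A p \<in> U}"
        using dist_kemb_le[of A p q] e(2)[of "kemb A q"] by (auto simp: dist_commute)
    qed (use e in auto)
  qed auto
qed auto

section \<open>The finite coordinate and Borel measurability of the Green kernel\<close>

definition kz :: "kpt \<Rightarrow> complex" where
  "kz p = (case zof p of None \<Rightarrow> 0 | Some z \<Rightarrow> z)"

text \<open>Inverse stereographic projection; at infinity both sides are 0 because 0 / 0 = 0.\<close>
lemma kz_eq_kemb: "kz p = fst (fst (kemb A p)) / of_real (1 - snd (fst (kemb A p)))"
proof (cases p)
  case (KPt z b)
  have "1 + (cmod z)\<^sup>2 \<noteq> 0" using one_plus_norm_sq_pos[of z] by simp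
  hence "1 - ((cmod z)\<^sup>2 - 1) / (1 + (cmod z)\<^sup>2) = 2 / (1 + (cmod z)\<^sup>2)"
    by (simp add: field_simps)
  thus ?thesis using \<open>1 + (cmod z)\<^sup>2 \<noteq> 0\<close>
    by (simp add: KPt kz_def kemb_def stereo_def del: of_real_divide of_real_add of_real_diff)
qed (simp add: kz_def kemb_def stereo_def)

lemma space_Kborel [simp]: "space (Kborel A) = Kbar A"
  unfolding Kborel_def using openin_subset[of "Ktop A"] by (subst space_measure_of) auto

lemma sets_Kborel_open: "openin (Ktop A) U \<Longrightarrow> U \<in> sets (Kborel A)"
  unfolding Kborel_def using openin_subset[of "Ktop A"] by (subst sets_measure_of) (auto intro!: sigma_sets.Basic)

lemma sets_Kborel_closed: "closedin (Ktop A) U \<Longrightarrow> U \<in> sets (Kborel A)"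
  using sets_Kborel_open[of A "Kbar A - U"] sets.compl_sets[of "Kbar A - U" "Kborel A"]
  by (auto simp: closedin_def double_diff)

lemma kemb_measurable [measurable]: "kemb A \<in> borel_measurable (Kborel A)"
proof (rule borel_measurableI)
  fix U :: "((complex \<times> real) \<times> (complex \<times> real)) set" assume "open U"
  hence "openin (Ktop A) {p \<in> topspace (Ktop A). kemb A p \<in> U}"
    using continuous_map_kemb[of A] unfolding continuous_map_def by auto
  moreover have "kemb A -` U \<inter> space (Kborel A) = {p \<in> topspace (Ktop A). kemb A p \<in> U}" by auto
  ultimately show "kemb A -` U \<inter> space (Kborel A) \<in> sets (Kborel A)"
    using sets_Kborel_open by metis
qed

lemma kz_measurable [measurable]: "kz \<in> borel_measurable (Kborel A)"
proof -
  have "(\<lambda>x :: (complex \<times> real) \<times> (complex \<times> real). fst (fst x)) \<in> borel_measurable borel"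
       "(\<lambda>x :: (complex \<times> real) \<times> (complex \<times> real). complex_of_real (1 - snd (fst x))) \<in> borel_measurable borel"
    by (intro borel_measurable_continuous_onI continuous_intros)+
  from this[THEN measurable_compose[OF kemb_measurable[of A]]]
  have "(\<lambda>p. fst (fst (kemb A p)) / of_real (1 - snd (fst (kemb A p)))) \<in> borel_measurable (Kborel A)"
    by (rule borel_measurable_divide)
  thus ?thesis using kz_eq_kemb[of _ A] by presburger
qed

lemma KInf_in_sets [measurable]: "{p \<in> Kbar A. p = KInf} \<in> sets (Kborel A)"
proof -
  have "{p \<in> Kbar A. p = KInf} = kemb A -` {kemb A KInf} \<inter> space (Kborel A)"
  proof -
    have "KInf \<in> Kbar A" by (simp add: Kbar_def)
    thus ?thesis using inj_onD[OF kemb_inj_on[of A], of _ KInf] by auto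
  qed
  also have "\<dots> \<in> sets (Kborel A)" by measurable
  finally show ?thesis .
qed

lemma KInf_pred_measurable [measurable]: "Measurable.pred (Kborel A) (\<lambda>p. p = KInf)"
  using KInf_in_sets[of A] by (simp add: pred_def)

lemma Gk_eq: "Gk p q = (if p = KInf \<or> q = KInf then 0 else Gc (kz p) (kz q))"
  by (cases p; cases q) (auto simp: Gk_def kz_def)

lemma Gk_measurable [measurable]:
  "(\<lambda>(p, q). Gk p q) \<in> borel_measurable (Kborel A \<Otimes>\<^sub>M Kborel A)"
proof -
  let ?M = "Kborel A \<Otimes>\<^sub>M Kborel A"
  have [measurable]: "(\<lambda>x. kz (fst x)) \<in> borel_measurable ?M" "(\<lambda>x. kz (snd x)) \<in> borel_measurable ?M"
    by (rule measurable_compose[OF measurable_fst kz_measurable] measurable_compose[OF measurable_snd kz_measurable])+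
  have [measurable]: "(\<lambda>x. cnj (kz (snd x))) \<in> borel_measurable ?M"
    by (rule measurable_compose[of _ _ borel]) (auto intro!: borel_measurable_continuous_onI continuous_intros)
  have [measurable]: "Measurable.pred ?M (\<lambda>x. fst x = KInf)" "Measurable.pred ?M (\<lambda>x. snd x = KInf)"
    by (rule measurable_compose[OF measurable_fst KInf_pred_measurable] measurable_compose[OF measurable_snd KInf_pred_measurable])+
  have [measurable]: "Measurable.pred ?M (\<lambda>x. kz (fst x) = kz (snd x))"
  proof -
    have "Measurable.pred ?M (\<lambda>x. kz (fst x) - kz (snd x) \<in> {0})" by measurable
    thus ?thesis by simp
  qed
  show ?thesis unfolding Gk_eq Gc_def split_beta by measurable
qed

section \<open>Borel sections over compact sets\<close>

text \<open>At the first index \<open>n\<close> where the digits differ the terms differ by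
  \<open>(1/3) ^ n\<close>, while all later terms together contribute at most half of that. In base
  2 the tail could compensate the difference.\<close>

lemma ternary_digits_inject:
  fixes a b :: "nat \<Rightarrow> bool"
  assumes "(\<Sum>n. (1/3) ^ n * of_bool (a n)) = (\<Sum>n. (1/3::real) ^ n * of_bool (b n))"
  shows "a = b"
proof (rule ccontr)
  assume "a \<noteq> b"
  hence ex: "\<exists>n. a n \<noteq> b n" by auto
  define n where "n = (LEAST n. a n \<noteq> b n)"
  have n: "a n \<noteq> b n" using LeastI_ex[OF ex] by (simp add: n_def)
  have below: "a k = b k" if "k < n" for k
    using not_less_Least[of k "\<lambda>n. a n \<noteq> b n"] that by (auto simp: n_def)
  have summ: "summable (\<lambda>n. (1/3::real) ^ n * of_bool (c n))" for c :: "nat \<Rightarrow> bool"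
    by (rule summable_comparison_test'[of "\<lambda>n. (1/3::real) ^ n" 0]) (auto simp: summable_geometric)
  define d :: "nat \<Rightarrow> real" where "d k = (1/3) ^ k * of_bool (a k) - (1/3) ^ k * of_bool (b k)" for k
  have sd: "summable d" unfolding d_def by (intro summable_diff summ)
  have "suminf d = 0" unfolding d_def using assms summ by (subst suminf_diff[symmetric]) auto
  moreover have "suminf d = (\<Sum>k. d (k + Suc n)) + (\<Sum>k<Suc n. d k)"
    by (rule suminf_split_initial_segment[OF sd])
  moreover have "(\<Sum>k<Suc n. d k) = d n" by (simp add: d_def below)
  moreover have "\<bar>d n\<bar> = (1/3) ^ n" using n by (cases "a n") (auto simp: d_def)
  moreover have "\<bar>\<Sum>k. d (k + Suc n)\<bar> \<le> (\<Sum>k. (1/3) ^ (k + Suc n))"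
  proof -
    have dle: "\<bar>d (k + Suc n)\<bar> \<le> (1/3) ^ (k + Suc n)" for k by (auto simp: d_def of_bool_def)
    have s: "summable (\<lambda>k. (1/3::real) ^ (k + Suc n))"
      by (simp only: power_add) (intro summable_mult2 summable_geometric, simp)
    have s2: "summable (\<lambda>k. \<bar>d (k + Suc n)\<bar>)"
      by (rule summable_comparison_test'[OF s, of 0]) (use dle in auto)
    have "\<bar>\<Sum>k. d (k + Suc n)\<bar> \<le> (\<Sum>k. \<bar>d (k + Suc n)\<bar>)" by (rule summable_rabs[OF s2])
    also have "\<dots> \<le> (\<Sum>k. (1/3) ^ (k + Suc n))" by (rule suminf_le[OF dle s2 s])
    finally show ?thesis .
  qed
  moreover have "(\<Sum>k. (1/3::real) ^ (k + Suc n)) = (1/3) ^ n / 2"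
    using suminf_mult2[of "\<lambda>k. (1/3::real)^k" "(1/3) ^ Suc n"] suminf_geometric[of "1/3::real"]
    by (simp add: power_add)
  moreover have "(1/3::real) ^ n > 0" by simp
  ultimately show False by linarith
qed

text \<open>Minimising an injective lower semicontinuous function on each fibre of \<open>f\<close> selects a point
  of the fibre in a Borel way; a weighted sum of indicators of a countable base is such a function.\<close>
lemma borel_section_exists:
  fixes f :: "'a::{t2_space, second_countable_topology} \<Rightarrow> real"
  assumes K: "compact K" "K \<noteq> {}" and f: "continuous_on K f"
  obtains \<sigma> where "\<sigma> \<in> borel_measurable borel" "\<And>\<rho>. \<sigma> \<rho> \<in> K" "\<And>\<rho>. \<rho> \<in> f ` K \<Longrightarrow> f (\<sigma> \<rho>) = \<rho>"
proof -
  obtain \<B> :: "'a set set" where B: "countable \<B>" "topological_basis \<B>" using ex_countable_basis by blast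
  have Bne: "\<B> \<noteq> {}"
  proof
    assume "\<B> = {}"
    hence "open U \<Longrightarrow> U = {}" for U :: "'a set" using B(2) by (auto simp: topological_basis_def)
    thus False using open_UNIV by blast
  qed
  define U where "U = from_nat_into \<B>"
  have Uopen: "open (U n)" for n
    using topological_basis_open[OF B(2)] from_nat_into[OF Bne] by (auto simp: U_def)
  have sep: "\<exists>n. (y \<in> U n) \<noteq> (y' \<in> U n)" if ne: "y \<noteq> y'" for y y'
  proof -
    obtain V where "open V" "y \<in> V" "y' \<notin> V" using ne by (meson hausdorff disjoint_iff)
    then obtain W where "W \<in> \<B>" "y \<in> W" "W \<subseteq> V" using topological_basisE[OF B(2)] by metis
    moreover then obtain n where "W = U n" using from_nat_into_surj[OF B(1)] by (metis U_def)
    ultimately show ?thesis using \<open>y' \<notin> V\<close> by auto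
  qed
  define c :: "'a \<Rightarrow> real" where "c y = (\<Sum>n. (1/3) ^ n * of_bool (y \<in> U n))" for y
  have summ: "summable (\<lambda>n. (1/3::real) ^ n * of_bool (y \<in> U n))" for y
    by (rule summable_comparison_test'[of "\<lambda>n. (1/3::real) ^ n" 0]) (auto simp: summable_geometric)
  have c_inj: "y = y'" if "c y = c y'" for y y'
    using ternary_digits_inject[of "\<lambda>n. y \<in> U n" "\<lambda>n. y' \<in> U n"] that sep[of y y']
    unfolding c_def by metis
  \<comment> \<open>Lower semicontinuity of \<open>c\<close>: a partial sum exceeding
    \<open>t\<close> involves finitely many base sets around \<open>y\<close>, and on their
    intersection \<open>W\<close> this partial sum does not drop.\<close>
  have c_closed: "closed {y. c y \<le> t}" for t
  proof -
    have "open {y. t < c y}"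
    proof (subst open_subopen, safe)
      fix y assume "t < c y"
      moreover have "(\<lambda>N. \<Sum>n<N. (1/3) ^ n * of_bool (y \<in> U n)) \<longlonglongrightarrow> c y"
        unfolding c_def by (rule summable_LIMSEQ[OF summ])
      ultimately obtain N where N: "t < (\<Sum>n<N. (1/3) ^ n * of_bool (y \<in> U n))"
        by (metis (no_types, lifting) order_tendstoD(1) eventually_sequentially order_refl)
      define W where "W = (\<Inter>n\<in>{n. n < N \<and> y \<in> U n}. U n)"
      have "t < c y'" if "y' \<in> W" for y'
      proof -
        have "(\<Sum>n<N. (1/3::real) ^ n * of_bool (y \<in> U n)) \<le> (\<Sum>n<N. (1/3) ^ n * of_bool (y' \<in> U n))"
          using that by (intro sum_mono) (auto simp: W_def)
        also have "\<dots> \<le> c y'" unfolding c_def by (intro sum_le_suminf[OF summ]) auto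
        finally show ?thesis using N by linarith
      qed
      moreover have "open W" "y \<in> W" unfolding W_def using Uopen by (auto intro!: open_INT)
      ultimately show "\<exists>T. open T \<and> y \<in> T \<and> T \<subseteq> {y. t < c y}" by blast
    qed
    moreover have "{y. c y \<le> t} = - {y. t < c y}" by auto
    ultimately show ?thesis by (simp add: closed_def)
  qed
  have fib: "compact {y \<in> K. f y = \<rho>}" for \<rho>
  proof -
    have "closed (K \<inter> f -` {\<rho>})"
      using f compact_imp_closed[OF K(1)] by (intro continuous_closed_preimage) auto
    hence "compact (K \<inter> (K \<inter> f -` {\<rho>}))" using K by (intro compact_Int_closed)
    moreover have "K \<inter> (K \<inter> f -` {\<rho>}) = {y \<in> K. f y = \<rho>}" by auto
    ultimately show ?thesis by simp
  qed
  \<comment> \<open>The minimum over a compact set is attained, because the closed sublevel sets at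
    the values taken there have the finite intersection property.\<close>
  have att: "\<exists>y\<in>S. \<forall>y'\<in>S. c y \<le> c y'" if S: "compact S" "S \<noteq> {}" for S
  proof -
    have "S \<inter> \<Inter> ((\<lambda>y. {y'. c y' \<le> c y}) ` S) \<noteq> {}"
    proof (rule compact_imp_fip[OF S(1)])
      fix \<F> assume F: "finite \<F>" "\<F> \<subseteq> (\<lambda>y. {y'. c y' \<le> c y}) ` S"
      then obtain Y where Y: "finite Y" "Y \<subseteq> S" "\<F> = (\<lambda>y. {y'. c y' \<le> c y}) ` Y"
        by (meson finite_subset_image)
      show "S \<inter> \<Inter> \<F> \<noteq> {}"
      proof (cases "Y = {}")
        case False
        then obtain y where "y \<in> Y" "\<forall>y'\<in>Y. c y \<le> c y'"
          using Y(1) arg_min_if_finite(1)[of Y c] arg_min_least[of Y _ c] by blast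
        thus ?thesis using Y by auto
      qed (use Y S in auto)
    qed (use c_closed in auto)
    thus ?thesis by auto
  qed
  obtain k0 where k0: "k0 \<in> K" using K by auto
  define \<sigma> where "\<sigma> \<rho> = (if \<rho> \<in> f ` K then SOME y. y \<in> K \<and> f y = \<rho> \<and> (\<forall>y'\<in>K. f y' = \<rho> \<longrightarrow> c y \<le> c y') else k0)" for \<rho>
  have \<sigma>: "\<sigma> \<rho> \<in> K \<and> f (\<sigma> \<rho>) = \<rho> \<and> (\<forall>y'\<in>K. f y' = \<rho> \<longrightarrow> c (\<sigma> \<rho>) \<le> c y')" if "\<rho> \<in> f ` K" for \<rho>
  proof -
    have "\<exists>y. y \<in> K \<and> f y = \<rho> \<and> (\<forall>y'\<in>K. f y' = \<rho> \<longrightarrow> c y \<le> c y')"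
      using att[OF fib[of \<rho>]] that by auto
    from someI_ex[OF this] show ?thesis using that by (simp add: \<sigma>_def)
  qed
  define L where "L C t = f ` (K \<inter> C \<inter> {y. c y \<le> t})" for C t
  have L: "closed (L C t)" if "closed C" for C t
    unfolding L_def
    by (intro compact_imp_closed compact_continuous_image compact_Int_closed that c_closed K
        continuous_on_subset[OF f]) auto
  \<comment> \<open>\<open>\<sigma> \<rho>\<close> minimises \<open>c\<close> on the fibre, so it
    avoids \<open>C\<close> exactly when the minimum over the fibre lies strictly below the values
    on its part in \<open>C\<close>; a rational level \<open>t\<close> separates the two. The sets
    \<open>L C t\<close> are compact images, which makes the countable union Borel.\<close>
  have key: "{\<rho> \<in> f ` K. \<sigma> \<rho> \<notin> C} = (\<Union>t\<in>\<rat>. L UNIV t - L C t)" if C: "closed C" for C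
  proof safe
    fix y assume y: "y \<in> K" "\<sigma> (f y) \<notin> C"
    define \<rho> where "\<rho> = f y"
    have \<rho>: "\<rho> \<in> f ` K" using y by (simp add: \<rho>_def)
    note s = \<sigma>[OF \<rho>]
    have "\<exists>t\<in>\<rat>. c (\<sigma> \<rho>) \<le> t \<and> \<rho> \<notin> L C t"
    proof (cases "{y \<in> K. f y = \<rho>} \<inter> C = {}")
      case True
      obtain t where "t \<in> \<rat>" "c (\<sigma> \<rho>) < t" "t < c (\<sigma> \<rho>) + 1" using Rats_dense_in_real[of "c (\<sigma> \<rho>)" "c (\<sigma> \<rho>) + 1"] by auto
      thus ?thesis using True by (intro bexI[of _ t]) (auto simp: L_def)
    next
      case False
      obtain y1 where y1: "y1 \<in> {y \<in> K. f y = \<rho>} \<inter> C" "\<forall>y'\<in>{y \<in> K. f y = \<rho>} \<inter> C. c y1 \<le> c y'"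
        using att[OF compact_Int_closed[OF fib C] False] by auto
      \<comment> \<open>Injectivity of \<open>c\<close> enters here: equal values would give
        \<open>\<sigma> \<rho> = y1\<close>, a point of \<open>C\<close>.\<close>
      have "c (\<sigma> \<rho>) \<noteq> c y1" using c_inj[of "\<sigma> \<rho>" y1] y1 y by (auto simp: \<rho>_def)
      hence "c (\<sigma> \<rho>) < c y1" using s y1 by force
      then obtain t where "t \<in> \<rat>" "c (\<sigma> \<rho>) < t" "t < c y1" using Rats_dense_in_real by blast
      thus ?thesis using y1 by (intro bexI[of _ t]) (force simp: L_def)+
    qed
    then obtain t where "t \<in> \<rat>" "c (\<sigma> \<rho>) \<le> t" "\<rho> \<notin> L C t" by auto
    moreover have "\<rho> \<in> L UNIV t" using s \<open>c (\<sigma> \<rho>) \<le> t\<close> by (auto simp: L_def intro!: rev_image_eqI[of "\<sigma> \<rho>"])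
    ultimately show "f y \<in> (\<Union>t\<in>\<rat>. L UNIV t - L C t)" by (auto simp: \<rho>_def)
  next
    fix \<rho> t assume "\<rho> \<in> L UNIV t" thus "\<rho> \<in> f ` K" by (auto simp: L_def)
  next
    fix \<rho> t assume *: "\<rho> \<in> L UNIV t" "\<rho> \<notin> L C t" "\<sigma> \<rho> \<in> C"
    then obtain y where y: "y \<in> K" "f y = \<rho>" "c y \<le> t" by (auto simp: L_def)
    have s: "\<sigma> \<rho> \<in> K" "f (\<sigma> \<rho>) = \<rho>" "c (\<sigma> \<rho>) \<le> c y" using \<sigma>[of \<rho>] y by auto
    have "\<rho> \<in> L C t" unfolding L_def by (rule rev_image_eqI[of "\<sigma> \<rho>"]) (use s * y in auto)
    thus False using * by simp
  qed
  have cfK: "closed (f ` K)" using K f by (intro compact_imp_closed compact_continuous_image)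
  have "\<sigma> \<in> borel_measurable borel"
  proof (rule borel_measurableI)
    fix V :: "'a set" assume "open V"
    hence C: "closed (- V)" by (rule closed_Compl)
    have "\<sigma> -` V \<inter> space borel = {\<rho> \<in> f ` K. \<sigma> \<rho> \<notin> - V} \<union> (if k0 \<in> V then - (f ` K) else {})"
      by (auto simp: \<sigma>_def split: if_splits)
    also have "\<dots> \<in> sets borel"
    proof (rule sets.Un)
      show "{\<rho> \<in> f ` K. \<sigma> \<rho> \<notin> - V} \<in> sets borel"
        unfolding key[OF C] using L[OF C] L[of UNIV] countable_rat
        by (intro sets.countable_UN'' sets.Diff borel_closed) auto
      show "(if k0 \<in> V then - (f ` K) else {}) \<in> sets borel"
        using borel_comp[OF borel_closed[OF cfK]] by simp
    qed
    finally show "\<sigma> -` V \<inter> space borel \<in> sets borel" .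
  qed
  moreover have "\<sigma> \<rho> \<in> K" for \<rho> using \<sigma>[of \<rho>] k0 by (cases "\<rho> \<in> f ` K") (auto simp: \<sigma>_def)
  ultimately show ?thesis using that[of \<sigma>] \<sigma> by blast
qed

section \<open>Logarithmic potentials of the slit\<close>

text \<open>The bound is uniform in \<open>s\<close>: within distance 1 of \<open>s\<close> the
  integral is at most 2 on either side, and farther away the integrand is at most 1 on an interval
  of length 1.\<close>

lemma nn_integral_inverse_sqrt_le:
  "(\<integral>\<^sup>+u. ennreal (1 / sqrt \<bar>u - s\<bar>) * indicator {0..1} u \<partial>lborel) \<le> 5"
proof -
  define k where "k x = ennreal (1 / sqrt x) * indicator {0..1} x" for x :: real
  define g where "g x = ennreal (1 / sqrt \<bar>x\<bar>) * indicator {-1..1} x" for x :: real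
  have [measurable]: "k \<in> borel_measurable borel" "g \<in> borel_measurable borel"
    unfolding k_def[abs_def] g_def[abs_def] by measurable
  have "((\<lambda>x::real. x powr (-1/2)) has_integral 2) {0..1}"
    using has_integral_powr_from_0[of "-1/2" 1] by simp
  from nn_integral_has_integral_lebesgue'[OF _ this]
  have "(\<integral>\<^sup>+x. ennreal (x powr (-1/2)) * indicator {0..1} x \<partial>lborel) = ennreal 2"
    by simp
  moreover have "ennreal (x powr (-1/2)) * indicator {0..1} x = k x" for x
    by (cases "x \<in> {0..1}") (auto simp: k_def powr_half_sqrt powr_minus_divide)
  ultimately have k2: "(\<integral>\<^sup>+x. k x \<partial>lborel) = 2" by simp
  have k2': "(\<integral>\<^sup>+x. k (0 + (-1) * x) \<partial>lborel) = 2"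
    using nn_integral_real_affine[of k "-1" 0] k2 by simp
  have "(\<integral>\<^sup>+x. g x \<partial>lborel) \<le> (\<integral>\<^sup>+x. k x + k (0 + (-1) * x) \<partial>lborel)"
    by (intro nn_integral_mono) (auto simp: g_def k_def indicator_def)
  also have "\<dots> = 4"
    by (subst nn_integral_add) (auto simp: k2 k2'[simplified])
  finally have g4: "(\<integral>\<^sup>+x. g x \<partial>lborel) \<le> 4" .
  have g4': "(\<integral>\<^sup>+u. g (- s + 1 * u) \<partial>lborel) \<le> 4"
    using nn_integral_real_affine[of g 1 "-s"] g4 by simp
  have "ennreal (1 / sqrt \<bar>u - s\<bar>) * indicator {0..1} u \<le> indicator {0..1} u + g (- s + 1 * u)" for u
  proof (cases "\<bar>u - s\<bar> \<le> 1")
    case False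
    hence "1 / sqrt \<bar>u - s\<bar> \<le> 1" by simp
    hence "ennreal (1 / sqrt \<bar>u - s\<bar>) \<le> 1" by (metis ennreal_1 ennreal_leI)
    hence "ennreal (1 / sqrt \<bar>u - s\<bar>) * indicator {0..1} u \<le> 1 * indicator {0..1} u"
      by (rule mult_right_mono) (rule zero_le)
    thus ?thesis unfolding mult_1_left by (rule order_trans) (rule add_increasing2[OF zero_le order_refl])
  next
    case True
    hence "g (- s + 1 * u) = ennreal (1 / sqrt \<bar>u - s\<bar>)"
      by (simp add: g_def indicator_def abs_le_iff)
    moreover have "ennreal (1 / sqrt \<bar>u - s\<bar>) * indicator {0..1} u \<le> ennreal (1 / sqrt \<bar>u - s\<bar>) * 1"
      by (rule mult_left_mono) (auto simp: indicator_def)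
    ultimately show ?thesis by (simp add: add_increasing)
  qed
  hence "(\<integral>\<^sup>+u. ennreal (1 / sqrt \<bar>u - s\<bar>) * indicator {0..1} u \<partial>lborel)
      \<le> (\<integral>\<^sup>+u. indicator {0..1} u + g (- s + 1 * u) \<partial>lborel)"
    by (intro nn_integral_mono)
  also have "\<dots> = 1 + (\<integral>\<^sup>+u. g (- s + 1 * u) \<partial>lborel)"
    by (subst nn_integral_add) auto
  also have "\<dots> \<le> 1 + 4" by (rule add_left_mono[OF g4'])
  finally show ?thesis by simp
qed

lemma inverse_sqrt_integrable: "integrable lborel (\<lambda>u::real. indicator {0..1} u * (1 / sqrt \<bar>u - s\<bar>))"
  and inverse_sqrt_integral_le: "(LINT u|lborel. indicator {0..1} u * (1 / sqrt \<bar>u - s\<bar>)) \<le> 5"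
proof -
  have eq: "ennreal (indicator {0..1} u * (1 / sqrt \<bar>u - s\<bar>)) = ennreal (1 / sqrt \<bar>u - s\<bar>) * indicator {0..1} u" for u
    by (auto simp: indicator_def)
  have le: "(\<integral>\<^sup>+u. ennreal (indicator {0..1} u * (1 / sqrt \<bar>u - s\<bar>)) \<partial>lborel) \<le> ennreal 5"
    unfolding eq using nn_integral_inverse_sqrt_le[of s] by simp
  show int: "integrable lborel (\<lambda>u::real. indicator {0..1} u * (1 / sqrt \<bar>u - s\<bar>))"
    using le by (intro integrableI_nonneg) (auto simp: order_le_less_trans)
  have "ennreal (LINT u|lborel. indicator {0..1} u * (1 / sqrt \<bar>u - s\<bar>))
      = (\<integral>\<^sup>+u. ennreal (indicator {0..1} u * (1 / sqrt \<bar>u - s\<bar>)) \<partial>lborel)"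
    by (rule nn_integral_eq_integral[OF int, symmetric]) auto
  from le[folded this] show "(LINT u|lborel. indicator {0..1} u * (1 / sqrt \<bar>u - s\<bar>)) \<le> 5"
    by (subst (asm) ennreal_le_iff) auto
qed

section \<open>Hoelder continuity of Green potentials of the slit\<close>

text \<open>The inequality \<open>ln y \<le> y - 1\<close> is applied to the square root of the
  quotient. This gives Hoelder exponent 1/2 at the price of weights that are still integrable along
  the slit.\<close>

lemma ln_diff_le_sqrt:
  fixes x y :: real
  assumes "x > 0" "y > 0"
  shows "\<bar>ln x - ln y\<bar> \<le> 2 * sqrt \<bar>x - y\<bar> * (1 / sqrt x + 1 / sqrt y)"
proof -
  have *: "ln x - ln y \<le> 2 * sqrt (x - y) * (1 / sqrt y)" if xy: "0 < y" "y \<le> x" for x y :: real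
  proof -
    have "ln x - ln y = 2 * ln (sqrt (x / y))" using xy by (simp add: ln_sqrt ln_div)
    also have "\<dots> \<le> 2 * (sqrt (x / y) - 1)"
      using ln_le_minus_one[of "sqrt (x / y)"] xy by simp
    also have "sqrt (x / y) - 1 = (sqrt x - sqrt y) / sqrt y"
      using xy by (simp add: real_sqrt_divide diff_divide_distrib)
    also have "\<dots> \<le> sqrt (x - y) / sqrt y"
      using sqrt_add_le_add_sqrt[of "x - y" y] xy by (intro divide_right_mono) auto
    finally show ?thesis by simp
  qed
  have m: "2 * sqrt \<bar>x - y\<bar> * (1 / sqrt x) \<ge> 0" "2 * sqrt \<bar>x - y\<bar> * (1 / sqrt y) \<ge> 0" using assms by auto
  show ?thesis
  proof (cases "y \<le> x")
    case True
    hence "0 \<le> ln x - ln y" "\<bar>x - y\<bar> = x - y" using assms by auto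
    thus ?thesis using *[of y x] m assms True unfolding distrib_left by linarith
  next
    case False
    hence "0 \<le> ln y - ln x" "\<bar>x - y\<bar> = y - x" using assms by auto
    hence "\<bar>ln x - ln y\<bar> \<le> 2 * sqrt \<bar>x - y\<bar> * (1 / sqrt x)" using *[of x y] assms False by simp
    thus ?thesis using m unfolding distrib_left by linarith
  qed
qed

lemma Gr_of_real: "Gr (of_real r) \<eta> = 0"
proof -
  have "cmod (of_real r - cnj \<eta>) = cmod (of_real r - \<eta>)"
    by (metis complex_cnj_complex_of_real complex_cnj_diff complex_mod_cnj)
  thus ?thesis by (simp add: Gr_def)
qed

lemma inverse_sqrt_mono: "0 < (a::real) \<Longrightarrow> a \<le> b \<Longrightarrow> 1 / sqrt b \<le> 1 / sqrt a"
  by (simp add: frac_le)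

text \<open>The distances from \<open>z\<close> and \<open>z'\<close> to a point of the slit and to
  its conjugate are bounded below by differences of imaginary parts. The bound thus involves only
  inverse square roots in \<open>\<tau>\<close>, and the four excluded parameters form a null
  set.\<close>

lemma Gr_diff_le:
  fixes z z' :: complex and A \<tau> :: real
  assumes A: "A > 0" and ne: "\<tau> \<noteq> Im z / A" "\<tau> \<noteq> - Im z / A" "\<tau> \<noteq> Im z' / A" "\<tau> \<noteq> - Im z' / A"
  shows "\<bar>Gr z (\<i> * of_real (A * \<tau>)) - Gr z' (\<i> * of_real (A * \<tau>))\<bar>
     \<le> 2 * sqrt (cmod (z - z')) / sqrt A * (1 / sqrt \<bar>\<tau> - Im z / A\<bar> + 1 / sqrt \<bar>\<tau> - (- Im z / A)\<bar>
        + 1 / sqrt \<bar>\<tau> - Im z' / A\<bar> + 1 / sqrt \<bar>\<tau> - (- Im z' / A)\<bar>)"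
proof -
  define e where "e = \<i> * complex_of_real (A * \<tau>)"
  have ge: "A * \<bar>\<tau> - Im w / A\<bar> \<le> cmod (w - e)" "A * \<bar>\<tau> - (- Im w / A)\<bar> \<le> cmod (w - cnj e)" for w
  proof -
    have "A * \<bar>\<tau> - Im w / A\<bar> = \<bar>A * (\<tau> - Im w / A)\<bar>" using A by (simp add: abs_mult)
    also have "\<dots> = \<bar>Im (w - e)\<bar>" using A by (simp add: e_def algebra_simps abs_minus_commute)
    finally show "A * \<bar>\<tau> - Im w / A\<bar> \<le> cmod (w - e)" using abs_Im_le_cmod[of "w - e"] by simp
    have "A * \<bar>\<tau> - (- Im w / A)\<bar> = \<bar>A * (\<tau> - (- Im w / A))\<bar>" using A by (simp add: abs_mult)
    also have "\<dots> = \<bar>Im (w - cnj e)\<bar>" using A by (simp add: e_def algebra_simps)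
    finally show "A * \<bar>\<tau> - (- Im w / A)\<bar> \<le> cmod (w - cnj e)" using abs_Im_le_cmod[of "w - cnj e"] by simp
  qed
  have pos: "0 < A * \<bar>\<tau> - Im z / A\<bar>" "0 < A * \<bar>\<tau> - (- Im z / A)\<bar>"
     "0 < A * \<bar>\<tau> - Im z' / A\<bar>" "0 < A * \<bar>\<tau> - (- Im z' / A)\<bar>"
    using A ne by auto
  have G: "Gr w e = ln (cmod (w - cnj e)) - ln (cmod (w - e))"
    if "0 < cmod (w - e)" "0 < cmod (w - cnj e)" for w
    using that by (simp add: Gr_def ln_div)
  have P: "0 < cmod (z - e)" "0 < cmod (z - cnj e)" "0 < cmod (z' - e)" "0 < cmod (z' - cnj e)"
    using ge[of z] ge[of z'] pos by linarith+
  have L: "\<bar>ln (cmod (z - w)) - ln (cmod (z' - w))\<bar> \<le>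
     2 * sqrt (cmod (z - z')) * (1 / sqrt p + 1 / sqrt q)"
    if "0 < p" "p \<le> cmod (z - w)" "0 < q" "q \<le> cmod (z' - w)" for w p q
  proof -
    have "\<bar>cmod (z - w) - cmod (z' - w)\<bar> \<le> cmod (z - z')"
      using norm_triangle_ineq3[of "z - w" "z' - w"] by simp
    hence "\<bar>ln (cmod (z - w)) - ln (cmod (z' - w))\<bar> \<le>
       2 * sqrt (cmod (z - z')) * (1 / sqrt (cmod (z - w)) + 1 / sqrt (cmod (z' - w)))"
      using that by (intro order_trans[OF ln_diff_le_sqrt] mult_right_mono mult_left_mono) auto
    also have "\<dots> \<le> 2 * sqrt (cmod (z - z')) * (1 / sqrt p + 1 / sqrt q)"
      using that by (intro mult_left_mono add_mono inverse_sqrt_mono) auto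
    finally show ?thesis .
  qed
  have "\<bar>Gr z e - Gr z' e\<bar> \<le> \<bar>ln (cmod (z - e)) - ln (cmod (z' - e))\<bar> + \<bar>ln (cmod (z - cnj e)) - ln (cmod (z' - cnj e))\<bar>"
    using P by (simp add: G)
  also have "\<dots> \<le> 2 * sqrt (cmod (z - z')) * (1 / sqrt (A * \<bar>\<tau> - Im z / A\<bar>) + 1 / sqrt (A * \<bar>\<tau> - Im z' / A\<bar>))
     + 2 * sqrt (cmod (z - z')) * (1 / sqrt (A * \<bar>\<tau> - (- Im z / A)\<bar>) + 1 / sqrt (A * \<bar>\<tau> - (- Im z' / A)\<bar>))"
    by (intro add_mono L pos ge)
  also have "\<dots> = 2 * sqrt (cmod (z - z')) / sqrt A * (1 / sqrt \<bar>\<tau> - Im z / A\<bar> + 1 / sqrt \<bar>\<tau> - (- Im z / A)\<bar>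
        + 1 / sqrt \<bar>\<tau> - Im z' / A\<bar> + 1 / sqrt \<bar>\<tau> - (- Im z' / A)\<bar>)"
    by (simp add: real_sqrt_mult add_divide_distrib algebra_simps)
  finally show ?thesis by (simp add: e_def)
qed

context
  fixes A :: real and k :: "real \<Rightarrow> real"
  assumes A: "A > 0" and k: "continuous_on {0..1} k"
begin

text \<open>Integrand of a Green potential, with the slit parametrised by
  \<open>\<i> * A * \<tau>\<close>; the density \<open>k\<close> absorbs the factor \<open>A\<close>
  of the parametrisation.\<close>

definition slitpot_integrand :: "complex \<Rightarrow> real \<Rightarrow> real" where
  "slitpot_integrand z \<tau> = indicator {0..1} \<tau> * (Gr z (\<i> * of_real (A * \<tau>)) * k \<tau>)"

lemma slitpot_integrand_measurable: "slitpot_integrand z \<in> borel_measurable borel"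
proof -
  have [measurable]: "(\<lambda>\<tau>. indicator {0..1} \<tau> *\<^sub>R k \<tau>) \<in> borel_measurable borel"
    by (rule borel_measurable_continuous_on_indicator[OF _ k]) auto
  have [measurable]: "(\<lambda>\<tau>. cmod (z - cnj (\<i> * of_real (A * \<tau>)))) \<in> borel_measurable borel"
     "(\<lambda>\<tau>. cmod (z - \<i> * of_real (A * \<tau>))) \<in> borel_measurable borel"
    by (intro borel_measurable_continuous_onI continuous_intros)+
  have "(\<lambda>\<tau>. ln (cmod (z - cnj (\<i> * of_real (A * \<tau>))) / cmod (z - \<i> * of_real (A * \<tau>))) * (indicator {0..1} \<tau> *\<^sub>R k \<tau>)) \<in> borel_measurable borel"
    by measurable
  thus ?thesis by (simp add: slitpot_integrand_def[abs_def] Gr_def mult_ac)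
qed

lemma slitpot_integrable: "integrable lborel (slitpot_integrand z)"
  and slitpot_Holder: "\<exists>C. \<forall>z z'. \<bar>(LINT \<tau>|lborel. slitpot_integrand z \<tau>)
    - (LINT \<tau>|lborel. slitpot_integrand z' \<tau>)\<bar> \<le> C * sqrt (cmod (z - z'))"
proof -
  have "compact (k ` {0..1})" by (rule compact_continuous_image[OF k]) auto
  then obtain B where B: "B > 0" "\<And>\<tau>. \<tau> \<in> {0..1} \<Longrightarrow> \<bar>k \<tau>\<bar> \<le> B"
    using compact_imp_bounded[of "k ` {0..1}"] unfolding bounded_pos by auto
  define J where "J s u = indicator {0..1} u * (1 / sqrt \<bar>u - s\<bar>)" for s u :: real
  define D where "D z z' u = 2 * sqrt (cmod (z - z')) / sqrt A * B * (J (Im z / A) u + J (- Im z / A) u + J (Im z' / A) u + J (- Im z' / A) u)"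
    for z z' u
  have Ji: "integrable lborel (J s)" "(LINT u|lborel. J s u) \<le> 5" for s
    unfolding J_def by (rule inverse_sqrt_integrable inverse_sqrt_integral_le)+
  have Di: "integrable lborel (D z z')" for z z'
    unfolding D_def by (intro integrable_mult_right Bochner_Integration.integrable_add Ji)
  have AE_ne: "AE u in lborel. u \<noteq> (s::real)" for s by (rule AE_lborel_singleton)
  have le: "AE u in lborel. norm (slitpot_integrand z u - slitpot_integrand z' u) \<le> D z z' u" for z z'
    using AE_ne[of "Im z / A"] AE_ne[of "- Im z / A"] AE_ne[of "Im z' / A"] AE_ne[of "- Im z' / A"]
  proof eventually_elim
    case (elim u)
    show ?case
    proof (cases "u \<in> {0..1}")
      case True
      have "norm (slitpot_integrand z u - slitpot_integrand z' u) =
          \<bar>Gr z (\<i> * of_real (A * u)) - Gr z' (\<i> * of_real (A * u))\<bar> * \<bar>k u\<bar>"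
        using True by (simp add: slitpot_integrand_def abs_mult[symmetric] left_diff_distrib)
      also have "\<dots> \<le> (2 * sqrt (cmod (z - z')) / sqrt A * (1 / sqrt \<bar>u - Im z / A\<bar> + 1 / sqrt \<bar>u - (- Im z / A)\<bar>
        + 1 / sqrt \<bar>u - Im z' / A\<bar> + 1 / sqrt \<bar>u - (- Im z' / A)\<bar>)) * B"
        by (rule mult_mono[OF Gr_diff_le[OF A elim] B(2)[OF True]])
           (use A in \<open>auto intro!: mult_nonneg_nonneg add_nonneg_nonneg\<close>)
      also have "\<dots> = D z z' u" using True by (simp add: D_def J_def)
      finally show ?thesis .
    qed (simp add: slitpot_integrand_def D_def J_def)
  qed
  \<comment> \<open>The Green function vanishes for \<open>z = 0\<close>, so the difference bound
    with \<open>z' = 0\<close> is an integrable majorant.\<close>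
  have zero: "slitpot_integrand 0 = (\<lambda>_. 0)"
    using Gr_of_real[of 0] by (simp add: slitpot_integrand_def fun_eq_iff)
  have int: "integrable lborel (slitpot_integrand z)" for z
  proof (rule Bochner_Integration.integrable_bound[OF Di[of z 0]])
    show "AE u in lborel. norm (slitpot_integrand z u) \<le> norm (D z 0 u)"
      using le[of z 0] unfolding zero by eventually_elim auto
  qed (simp add: slitpot_integrand_measurable)
  show "integrable lborel (slitpot_integrand z)" by (rule int)
  show "\<exists>C. \<forall>z z'. \<bar>(LINT \<tau>|lborel. slitpot_integrand z \<tau>)
    - (LINT \<tau>|lborel. slitpot_integrand z' \<tau>)\<bar> \<le> C * sqrt (cmod (z - z'))"
  \<comment> \<open>The factor 2 of the kernel estimate times four integrals of at most 5.\<close>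
  proof (intro exI[of _ "40 * B / sqrt A"] allI)
    fix z z'
    have "\<bar>(LINT \<tau>|lborel. slitpot_integrand z \<tau>) - (LINT \<tau>|lborel. slitpot_integrand z' \<tau>)\<bar>
      = norm (LINT \<tau>|lborel. slitpot_integrand z \<tau> - slitpot_integrand z' \<tau>)"
      by (simp add: Bochner_Integration.integral_diff int)
    also have "\<dots> \<le> (LINT \<tau>|lborel. norm (slitpot_integrand z \<tau> - slitpot_integrand z' \<tau>))"
      by (rule integral_norm_bound)
    also have "\<dots> \<le> (LINT \<tau>|lborel. D z z' \<tau>)"
      using le by (intro integral_mono_AE Di integrable_norm Bochner_Integration.integrable_diff int)
    also have "\<dots> = 2 * sqrt (cmod (z - z')) / sqrt A * B * ((LINT u|lborel. J (Im z / A) u) + (LINT u|lborel. J (- Im z / A) u)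
        + (LINT u|lborel. J (Im z' / A) u) + (LINT u|lborel. J (- Im z' / A) u))"
      unfolding D_def
      by (simp only: Bochner_Integration.integral_mult_right_zero Bochner_Integration.integral_add
          Bochner_Integration.integrable_add Ji)
    also have "\<dots> \<le> 2 * sqrt (cmod (z - z')) / sqrt A * B * (5 + 5 + 5 + 5)"
      using Ji A B by (intro mult_left_mono add_mono) auto
    finally show "\<bar>(LINT \<tau>|lborel. slitpot_integrand z \<tau>) - (LINT \<tau>|lborel. slitpot_integrand z' \<tau>)\<bar> \<le> 40 * B / sqrt A * sqrt (cmod (z - z'))"
      by (simp add: mult_ac)
  qed
qed

end

section \<open>The external field\<close>

context
  fixes A x t :: real and \<rho>0 :: "complex \<Rightarrow> complex"
  assumes A: "0 < A"
    and hol: "\<rho>0 holomorphic_on {z. 0 < Im z}"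
    and cont: "continuous_on {z. 0 \<le> Im z} \<rho>0"
    and Re0: "\<forall>s\<in>{0..A}. Re (\<rho>0 (\<i> * complex_of_real s)) = 0"
    and Im_real: "\<forall>r::real. 0 < Im (\<rho>0 (complex_of_real r))"
begin

lemma slit_value: "u \<in> {0..1} \<Longrightarrow> \<rho>0 (\<i> * of_real (A * u)) = \<i> * of_real (Im (\<rho>0 (\<i> * of_real (A * u))))"
  using Re0[rule_format, of "A * u"] A by (simp add: complex_eq_iff mult_le_cancel_left1)

lemma continuous_slit_density: "continuous_on {0..1} (\<lambda>u. A * Im (\<rho>0 (\<i> * of_real (A * u))))"
  using A by (intro continuous_intros continuous_on_compose2[OF cont]) auto

text \<open>On the slit \<open>\<rho>0\<close> is purely imaginary, and so is the increment of the
  path; hence the measure \<open>- \<rho>0 d\<eta>\<close> is real with density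
  \<open>A * Im \<rho>0\<close> in the parameter \<open>u\<close>.\<close>

lemma green_potential_eq:
  "Re (contour_integral (linepath 0 (\<i> * complex_of_real A)) (\<lambda>\<eta>. complex_of_real (Gr z \<eta>) * (- \<rho>0 \<eta>)))
    = (LINT u|lborel. slitpot_integrand A (\<lambda>u. A * Im (\<rho>0 (\<i> * of_real (A * u)))) z u)"
proof -
  define k where "k u = A * Im (\<rho>0 (\<i> * of_real (A * u)))" for u
  have k: "continuous_on {0..1} k" unfolding k_def by (rule continuous_slit_density)
  define h where "h u = Gr z (\<i> * of_real (A * u)) * k u" for u
  have "integrable lborel (slitpot_integrand A k z)" by (rule slitpot_integrable[OF A k])
  hence "set_integrable lborel {0..1} h"
    by (simp add: set_integrable_def h_def slitpot_integrand_def[OF A k, abs_def])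
  note h = set_borel_integral_eq_integral[OF this]
  have "contour_integral (linepath 0 (\<i> * complex_of_real A)) (\<lambda>\<eta>. complex_of_real (Gr z \<eta>) * (- \<rho>0 \<eta>))
     = integral {0..1} (\<lambda>u. of_real (Gr z (linepath 0 (\<i> * of_real A) u)) * (- \<rho>0 (linepath 0 (\<i> * of_real A) u)) * (\<i> * of_real A))"
    unfolding contour_integral_integral by simp
  also have "\<dots> = integral {0..1} (\<lambda>u. complex_of_real (h u))"
  proof (rule integral_cong)
    fix u :: real assume u: "u \<in> {0..1}"
    have l: "linepath 0 (\<i> * of_real A) u = \<i> * complex_of_real (A * u)"
      by (simp add: linepath_def scaleR_conv_of_real mult_ac)
    show "of_real (Gr z (linepath 0 (\<i> * of_real A) u)) * (- \<rho>0 (linepath 0 (\<i> * of_real A) u)) * (\<i> * of_real A)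
       = complex_of_real (h u)"
      unfolding l by (subst slit_value[OF u]) (simp add: h_def k_def complex_eq_iff)
  qed
  also have "\<dots> = of_real (integral {0..1} h)"
    using integral_linear[OF h(1) bounded_linear_of_real] by (simp add: o_def)
  finally have "Re (contour_integral (linepath 0 (\<i> * complex_of_real A)) (\<lambda>\<eta>. complex_of_real (Gr z \<eta>) * (- \<rho>0 \<eta>)))
     = integral {0..1} h" by simp
  also have "\<dots> = (LINT u|lborel. slitpot_integrand A k z u)"
    using h(2) by (simp add: set_lebesgue_integral_def h_def slitpot_integrand_def[OF A k])
  finally show ?thesis unfolding k_def .
qed

lemma continuous_on_green_potential:
  "continuous_on UNIV (\<lambda>z. Re (contour_integral (linepath 0 (\<i> * complex_of_real A)) (\<lambda>\<eta>. complex_of_real (Gr z \<eta>) * (- \<rho>0 \<eta>))))"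
proof -
  define V where "V z = Re (contour_integral (linepath 0 (\<i> * complex_of_real A)) (\<lambda>\<eta>. complex_of_real (Gr z \<eta>) * (- \<rho>0 \<eta>)))" for z
  obtain C where C: "\<And>z z'. \<bar>V z - V z'\<bar> \<le> C * sqrt (cmod (z - z'))"
    using slitpot_Holder[OF A continuous_slit_density] unfolding V_def green_potential_eq by blast
  have "continuous (at z) V" for z
  proof -
    have "((\<lambda>y. C * sqrt (cmod (y - z))) \<longlongrightarrow> C * sqrt (cmod (z - z))) (at z)" by (intro tendsto_intros)
    hence "((\<lambda>y. C * sqrt (cmod (y - z))) \<longlongrightarrow> 0) (at z)" by simp
    hence "((\<lambda>y. V y - V z) \<longlongrightarrow> 0) (at z)"
      by (rule Lim_null_comparison[rotated]) (use C in simp)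
    thus ?thesis unfolding continuous_at by (rule LIM_zero_cancel)
  qed
  hence "continuous_on UNIV V" by (simp add: continuous_at_imp_continuous_on)
  thus ?thesis unfolding V_def .
qed

lemma continuous_on_tail_integral:
  "continuous_on {z. 0 \<le> Im z} (\<lambda>z. contour_integral (linepath z (\<i> * complex_of_real A)) \<rho>0)"
proof -
  have "continuous_on ({z. 0 \<le> Im z} \<times> cbox 0 (1::real))
     (\<lambda>(z, u). \<rho>0 ((1 - u) *\<^sub>R z + u *\<^sub>R (\<i> * complex_of_real A)) * (\<i> * complex_of_real A - z))"
    unfolding split_beta using A
    by (intro continuous_intros continuous_on_compose2[OF cont]) auto
  from integral_continuous_on_param[OF this]
  show ?thesis by (simp add: contour_integral_integral linepath_def)
qed

lemma continuous_on_phi: "continuous_on {z. 0 \<le> Im z} (phi A \<rho>0 x t)"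
  unfolding phi_def
  by (intro continuous_intros continuous_on_tail_integral continuous_on_subset[OF continuous_on_green_potential]) auto

text \<open>On the real axis the Green potential vanishes and the polynomial part is
  \<open>\<i>\<close> times a real number. Cauchy's theorem moves the path of the remaining integral
  through 0; the leg along the slit has a real integral and drops out, which leaves the leg along
  the real axis.\<close>

lemma phi_of_real:
  "phi A \<rho>0 x t (of_real a) = - pi * a * integral {0..1} (\<lambda>u. Im (\<rho>0 (of_real (a * u))))"
proof -
  let ?b = "\<i> * complex_of_real A" and ?a = "complex_of_real a"
  have sub: "closed_segment p q \<subseteq> {z. 0 \<le> Im z}" if "0 \<le> Im p" "0 \<le> Im q" for p q
    by (rule closed_segment_subset) (use that in \<open>auto simp: convex_halfspace_Im_ge\<close>)
  have cs: "continuous_on (closed_segment p q) \<rho>0" if "0 \<le> Im p" "0 \<le> Im q" for p q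
    by (rule continuous_on_subset[OF cont sub]) (use that in auto)
  have hull: "convex hull {0, ?a, ?b} \<subseteq> {z. 0 \<le> Im z}"
    using A by (intro hull_minimal) (auto simp: convex_halfspace_Im_ge)
  hence "interior (convex hull {0, ?a, ?b}) \<subseteq> interior {z. 0 \<le> Im z}" by (rule interior_mono)
  also have "interior {z. 0 \<le> Im z} = {z. 0 < Im z}"
    using interior_halfspace_ge[of \<i> 0] by (simp add: inner_complex_def)
  \<comment> \<open>Holomorphy is known only in the open half-plane, and one side of the triangle
    lies on its boundary; continuity on the closed triangle makes up for this.\<close>
  finally have "(\<rho>0 has_contour_integral 0) (linepath 0 ?a +++ linepath ?a ?b +++ linepath ?b 0)"
    using hull hol cont by (intro Cauchy_theorem_triangle_interior)
       (auto intro: continuous_on_subset holomorphic_on_subset)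
  moreover have "(\<rho>0 has_contour_integral (contour_integral (linepath 0 ?a) \<rho>0
      + (contour_integral (linepath ?a ?b) \<rho>0 + contour_integral (linepath ?b 0) \<rho>0)))
      (linepath 0 ?a +++ linepath ?a ?b +++ linepath ?b 0)"
    using A by (intro has_contour_integral_join has_contour_integral_integral contour_integrable_continuous_linepath cs) auto
  ultimately have "contour_integral (linepath 0 ?a) \<rho>0
      + (contour_integral (linepath ?a ?b) \<rho>0 + contour_integral (linepath ?b 0) \<rho>0) = 0"
    by (rule has_contour_integral_unique[symmetric])
  moreover have "contour_integral (linepath ?b 0) \<rho>0 = - contour_integral (linepath 0 ?b) \<rho>0"
    using A by (intro contour_integral_reverse_linepath cs) auto
  ultimately have eq: "contour_integral (linepath ?a ?b) \<rho>0 = contour_integral (linepath 0 ?b) \<rho>0 - contour_integral (linepath 0 ?a) \<rho>0"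
    by (simp add: algebra_simps eq_neg_iff_add_eq_0)
  have "contour_integral (linepath 0 ?b) \<rho>0 = integral {0..1} (\<lambda>u. complex_of_real (- A * Im (\<rho>0 (\<i> * of_real (A * u)))))"
    unfolding contour_integral_integral
  proof (rule integral_cong)
    fix u :: real assume u: "u \<in> {0..1}"
    have l: "linepath 0 ?b u = \<i> * complex_of_real (A * u)"
      by (simp add: linepath_def scaleR_conv_of_real mult_ac)
    show "\<rho>0 (linepath 0 ?b u) * vector_derivative (linepath 0 ?b) (at u) = complex_of_real (- A * Im (\<rho>0 (\<i> * of_real (A * u))))"
      unfolding l by (subst slit_value[OF u]) (simp add: complex_eq_iff)
  qed
  also have "\<dots> = of_real (integral {0..1} (\<lambda>u. - A * Im (\<rho>0 (\<i> * of_real (A * u)))))"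
    using integral_linear[OF integrable_continuous_real[OF continuous_on_minus[OF continuous_slit_density]],
        of complex_of_real, OF bounded_linear_of_real]
    unfolding o_def minus_mult_left .
  finally have I1: "Im (contour_integral (linepath 0 ?b) \<rho>0) = 0" by simp
  have cr: "continuous_on {0..1} (\<lambda>u. \<rho>0 (of_real (a * u)))"
    by (intro continuous_intros continuous_on_compose2[OF cont]) auto
  have ci: "continuous_on {0..1} (\<lambda>u. \<rho>0 (of_real (a * u)) * of_real a)"
    by (intro continuous_intros cr)
  have "contour_integral (linepath 0 ?a) \<rho>0 = integral {0..1} (\<lambda>u. \<rho>0 (of_real (a * u)) * of_real a)"
    unfolding contour_integral_integral by (simp add: linepath_def scaleR_conv_of_real mult_ac)
  hence "Im (contour_integral (linepath 0 ?a) \<rho>0) = integral {0..1} (\<lambda>u. Im (\<rho>0 (of_real (a * u)) * of_real a))"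
    using integral_linear[OF integrable_continuous_real[OF ci] bounded_linear_Im] by (simp only: o_def)
  also have "\<dots> = a * integral {0..1} (\<lambda>u. Im (\<rho>0 (of_real (a * u))))"
    by (simp add: mult.commute)
  finally have I2: "Im (contour_integral (linepath 0 ?a) \<rho>0) = a * integral {0..1} (\<lambda>u. Im (\<rho>0 (of_real (a * u))))" .
  show ?thesis unfolding phi_def
    by (simp add: Gr_of_real eq I1 I2 Re_power2 Im_power2)
qed

lemma phi_of_real_sign:
  "a > 0 \<Longrightarrow> phi A \<rho>0 x t (of_real a) < 0"
  "a \<le> 0 \<Longrightarrow> 0 \<le> phi A \<rho>0 x t (of_real a)"
proof -
  define I where "I = integral {0..1} (\<lambda>u. Im (\<rho>0 (of_real (a * u))))"
  have c: "continuous_on {0..1} (\<lambda>u. Im (\<rho>0 (of_real (a * u))))"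
    by (intro continuous_intros continuous_on_compose2[OF cont]) auto
  obtain u0 where u0: "\<forall>u\<in>{0..1}. Im (\<rho>0 (of_real (a * u0))) \<le> Im (\<rho>0 (of_real (a * u)))"
    using continuous_attains_inf[OF _ _ c] by auto
  have "0 < Im (\<rho>0 (of_real (a * u0)))" using Im_real by blast
  also have "\<dots> = integral {0..1::real} (\<lambda>u. Im (\<rho>0 (of_real (a * u0))))" by simp
  also have "\<dots> \<le> I" unfolding I_def
    by (intro integral_le integrable_continuous_real c continuous_on_const) (use u0 in auto)
  finally have "0 < I" .
  thus "a > 0 \<Longrightarrow> phi A \<rho>0 x t (of_real a) < 0" "a \<le> 0 \<Longrightarrow> 0 \<le> phi A \<rho>0 x t (of_real a)"
    unfolding phi_of_real I_def[symmetric] by (auto simp: mult_nonneg_nonpos mult_nonpos_nonneg)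
qed

end

section \<open>Continua in the closure\<close>

lemma FF_closedin: "F \<in> FF A \<Longrightarrow> closedin (Ktop A) F"
  by (auto simp: FF_def intro: compactin_imp_closedin[OF Hausdorff_Ktop])

lemma FF_in_sets: "F \<in> FF A \<Longrightarrow> F \<in> sets (Kborel A)"
  by (rule sets_Kborel_closed[OF FF_closedin])

lemma FF_subset: "F \<in> FF A \<Longrightarrow> F \<subseteq> Kbar A"
  by (auto simp: FF_def)

text \<open>Since \<open>d0\<close> is bounded by 2, the real supremum in \<open>hausd\<close> is
  taken over a bounded set and dominates each of its members.\<close>

lemma hausd_less_imp_near:
  assumes "F1 \<noteq> {}" "hausd A F1 F2 < \<delta>" "b \<in> F2"
  obtains a where "a \<in> F1" "d0 A a b < \<delta>"
proof -
  have bdd: "bdd_below ((\<lambda>a. d0 A a b) ` F1)" for b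
    by (rule bdd_belowI[of _ 0]) (auto simp: d0_ge_0)
  obtain a0 where a0: "a0 \<in> F1" using assms by auto
  have "(INF a\<in>F1. d0 A a b) \<le> 2" for b
    using cINF_lower[OF bdd a0, of b] d0_le_2[of A a0 b] by linarith
  hence "bdd_above ((\<lambda>b. INF a\<in>F1. d0 A a b) ` F2)" by (intro bdd_aboveI[of _ 2]) auto
  from cSUP_upper[OF assms(3) this] have "(INF a\<in>F1. d0 A a b) < \<delta>"
    using assms(2) by (simp add: hausd_def)
  thus thesis using cINF_less_iff[OF assms(1) bdd] that by blast
qed

lemma compact_kemb_image: "compactin (Ktop A) S \<Longrightarrow> compact (kemb A ` S)"
  using image_compactin[OF _ continuous_map_kemb] by fastforce

text \<open>The distance to \<open>b\<close> is at most \<open>r1\<close> at \<open>q\<close> and at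
  least \<open>r2\<close> at the point 0 of \<open>F\<close>, so by connectedness it takes all
  values in between. The Borel selection is made on the embedded image of \<open>F\<close> and
  pulled back.\<close>

lemma FF_radial_section:
  assumes F: "F \<in> FF A" and q: "q \<in> F" "chord (zof q) (Some b) \<le> r1"
    and r2: "r2 \<le> chord (Some 0) (Some b)"
  shows "\<exists>\<sigma>\<in>measurable borel (Kborel A). (\<forall>\<rho>. \<sigma> \<rho> \<in> F) \<and> (\<forall>\<rho>\<in>{r1..r2}. chord (zof (\<sigma> \<rho>)) (Some b) = \<rho>)"
proof -
  define E where "E = kemb A ` F"
  define f where "f y = dist (fst y) (stereo (Some b))" for y :: "(complex \<times> real) \<times> (complex \<times> real)"
  have fk: "f (kemb A p) = chord (zof p) (Some b)" for p
    by (simp add: f_def kemb_def chord_eq_dist)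
  have cE: "compact E" unfolding E_def using F by (intro compact_kemb_image) (auto simp: FF_def)
  have "connectedin euclidean E"
    unfolding E_def using F by (intro connectedin_continuous_map_image[OF continuous_map_kemb]) (auto simp: FF_def)
  hence conE: "connected E" by simp
  have ne: "E \<noteq> {}" using q by (auto simp: E_def)
  have contf: "continuous_on E f" unfolding f_def by (intro continuous_intros)
  have sub: "{r1..r2} \<subseteq> f ` E"
  proof
    fix \<rho> assume \<rho>: "\<rho> \<in> {r1..r2}"
    have "connected (f ` E)" by (rule connected_continuous_image[OF contf conE])
    moreover have "f (kemb A q) \<in> f ` E" using q by (auto simp: E_def)
    moreover have "f (kemb A (KPt 0 False)) \<in> f ` E" using F by (auto simp: E_def FF_def)
    ultimately show "\<rho> \<in> f ` E"
      using \<rho> q r2 connectedD_interval[of "f ` E" "f (kemb A q)" "f (kemb A (KPt 0 False))" \<rho>]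
      by (auto simp: fk)
  qed
  obtain s where s: "s \<in> borel_measurable borel" "\<And>\<rho>. s \<rho> \<in> E" "\<And>\<rho>. \<rho> \<in> f ` E \<Longrightarrow> f (s \<rho>) = \<rho>"
    using borel_section_exists[OF cE ne contf] by blast
  define \<sigma> where "\<sigma> \<rho> = inv_into F (kemb A) (s \<rho>)" for \<rho>
  have \<sigma>: "\<sigma> \<rho> \<in> F" "kemb A (\<sigma> \<rho>) = s \<rho>" for \<rho>
    using s(2)[of \<rho>] unfolding \<sigma>_def E_def by (auto intro: inv_into_into f_inv_into_f)
  have inj: "inj_on (kemb A) F" by (rule inj_on_subset[OF kemb_inj_on FF_subset[OF F]])
  have "\<sigma> \<in> measurable borel (Kborel A)"
    unfolding Kborel_def
  proof (rule measurable_measure_of)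
    show "{U. openin (Ktop A) U} \<subseteq> Pow (Kbar A)" using openin_subset[of "Ktop A"] by auto
    show "\<sigma> \<in> space borel \<rightarrow> Kbar A" using \<sigma>(1) FF_subset[OF F] by auto
    fix U assume "U \<in> {U. openin (Ktop A) U}"
    hence U: "closedin (Ktop A) (Kbar A - U)" using closedin_diff[OF closedin_topspace, of "Ktop A" U] by simp
    \<comment> \<open>The part of \<open>F\<close> outside \<open>U\<close> has a compact, hence
      closed, image, so \<open>\<sigma>\<close> lands in \<open>U\<close> exactly when
      \<open>s\<close> lands in an open set.\<close>
    have "compactin (Ktop A) (F \<inter> (Kbar A - U))"
      using F U by (intro compact_Int_closedin) (auto simp: FF_def)
    hence "closed (kemb A ` (F \<inter> (Kbar A - U)))" by (intro compact_imp_closed compact_kemb_image)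
    hence m: "s -` (- kemb A ` (F \<inter> (Kbar A - U))) \<inter> space borel \<in> sets borel"
      using s(1) by (intro measurable_sets[of s borel borel]) (auto intro: borel_comp)
    have "\<sigma> \<rho> \<in> U \<longleftrightarrow> s \<rho> \<notin> kemb A ` (F \<inter> (Kbar A - U))" for \<rho>
    proof -
      have "s \<rho> \<in> kemb A ` (F \<inter> (Kbar A - U)) \<longleftrightarrow> \<sigma> \<rho> \<in> F \<inter> (Kbar A - U)"
        unfolding \<sigma>(2)[symmetric] using inj_on_image_mem_iff[OF inj \<sigma>(1), of "F \<inter> (Kbar A - U)"] by auto
      thus ?thesis using \<sigma>(1) FF_subset[OF F] by auto
    qed
    hence "\<sigma> -` U \<inter> space borel = s -` (- kemb A ` (F \<inter> (Kbar A - U))) \<inter> space borel"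
      by auto
    thus "\<sigma> -` U \<inter> space borel \<in> sets borel" using m by simp
  qed
  moreover have "chord (zof (\<sigma> \<rho>)) (Some b) = \<rho>" if "\<rho> \<in> {r1..r2}" for \<rho>
    using s(3)[of \<rho>] sub that by (simp add: \<sigma>(2)[symmetric] fk subset_iff)
  ultimately show ?thesis using \<sigma>(1) by blast
qed

section \<open>Chordal against Euclidean distance\<close>

lemma chord_Some_le: "chord (Some z) (Some w) \<le> 2 * cmod (z - w)"
proof -
  have "1 * 1 \<le> (1 + (cmod z)\<^sup>2) * (1 + (cmod w)\<^sup>2)" by (intro mult_mono) auto
  hence "1 \<le> sqrt ((1 + (cmod z)\<^sup>2) * (1 + (cmod w)\<^sup>2))" by simp
  hence "2 * cmod (z - w) / sqrt ((1 + (cmod z)\<^sup>2) * (1 + (cmod w)\<^sup>2)) \<le> 2 * cmod (z - w) / 1"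
    by (intro divide_left_mono) auto
  thus ?thesis by (simp add: chord_def)
qed

text \<open>A point within chordal distance \<open>1 / sqrt (1 + R\<^sup>2)\<close> of the disc of radius \<open>R\<close> stays at
  that chordal distance from infinity, hence is finite.\<close>
lemma chord_small_imp:
  assumes z: "cmod z \<le> R" and c: "chord p (Some z) \<le> 1 / sqrt (1 + R\<^sup>2)"
  obtains w where "p = Some w" "cmod (w - z) \<le> (1 + R\<^sup>2) * chord p (Some z)"
proof -
  have R: "(cmod z)\<^sup>2 \<le> R\<^sup>2" using z by (intro power_mono) auto
  define L where "L = sqrt (1 + R\<^sup>2)"
  have L: "L > 0" "L\<^sup>2 = 1 + R\<^sup>2" by (auto simp: L_def add_pos_nonneg)
  have zL: "sqrt (1 + (cmod z)\<^sup>2) \<le> L" using R by (simp add: L_def)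
  have z0: "0 < sqrt (1 + (cmod z)\<^sup>2)" by (simp add: one_plus_norm_sq_pos)
  have "2 / L \<le> chord (Some z) None" using zL z0 L by (simp add: chord_def frac_le)
  hence far: "1 / L \<le> chord p None"
    using chord_triangle[of "Some z" None p] c chord_commute[of p "Some z"] by (simp add: L_def)
  hence "p \<noteq> None" using L divide_pos_pos[of 1 L] by (cases p) auto
  then obtain w where w: "p = Some w" by auto
  have w0: "0 < sqrt (1 + (cmod w)\<^sup>2)" by (simp add: one_plus_norm_sq_pos)
  have "1 / L \<le> 2 / sqrt (1 + (cmod w)\<^sup>2)" using far by (simp add: w chord_def)
  hence wL: "sqrt (1 + (cmod w)\<^sup>2) \<le> 2 * L" using w0 L by (simp add: field_simps)
  have "cmod (w - z) = chord p (Some z) * (sqrt (1 + (cmod w)\<^sup>2) * sqrt (1 + (cmod z)\<^sup>2)) / 2"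
    using w0 z0 by (simp add: w chord_def real_sqrt_mult)
  also have "\<dots> \<le> chord p (Some z) * ((2 * L) * L) / 2"
    using wL zL w0 z0 L by (intro divide_right_mono mult_left_mono mult_mono) auto
  also have "\<dots> = (1 + R\<^sup>2) * chord p (Some z)" using L(2) by (simp add: power2_eq_square)
  finally show thesis using that w by blast
qed

section \<open>Estimates for the Green kernel\<close>

lemma cmod_diff_cnj_sq: "(cmod (z - cnj w))\<^sup>2 = (cmod (z - w))\<^sup>2 + 4 * Im z * Im w"
  unfolding cmod_power2 by (simp add: power2_eq_square algebra_simps)

lemma cmod_diff_le_cnj: "0 \<le> Im z \<Longrightarrow> 0 \<le> Im w \<Longrightarrow> cmod (z - w) \<le> cmod (z - cnj w)"
  by (rule power2_le_imp_le) (simp_all add: cmod_diff_cnj_sq)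

lemma Gc_eq:
  assumes "z \<noteq> w" "z \<noteq> cnj w"
  shows "Gc z w = ennreal (ln (cmod (z - cnj w)) - ln (cmod (z - w)))"
  using assms by (simp add: Gc_def ln_div)

lemma nn_integral_unit_const: "(\<integral>\<^sup>+v. c * indicator {0..1::real} v \<partial>lborel) = c"
  by (subst nn_integral_cmult_indicator) auto

text \<open>The points \<open>Z v\<close> near \<open>q\<close> are spread out: \<open>z\<close>
  comes close to them only for \<open>v\<close> near \<open>s\<close>. If \<open>p\<close> and
  \<open>q\<close> are far apart compared with \<open>r\<close>, all distances change by a factor
  near 1. Otherwise averaging over \<open>v\<close> bounds the kernel by \<open>ln (1 / r)\<close>
  up to constants, and these are absorbed by \<open>\<kappa>\<close> times the then large value at
  \<open>p\<close>, \<open>q\<close>. The threshold \<open>r0\<close> depends on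
  \<open>\<kappa>\<close>, \<open>h\<close> and \<open>D\<close> alone.\<close>

lemma green_kernel_perturb:
  assumes \<kappa>: "\<kappa> > 0" and h: "h > 0" and D: "D > 0"
  shows "\<exists>r0>0. \<forall>r p q z Z s. 0 < r \<and> r < r0 \<and> h \<le> Im p \<and> h \<le> Im q \<and> cmod (z - p) \<le> D * r \<and>
       (\<forall>v\<in>{0..1}. cmod (Z v - q) \<le> D * r \<and> r / 2 * \<bar>v - s\<bar> \<le> cmod (z - Z v))
     \<longrightarrow> (\<integral>\<^sup>+v. Gc z (Z v) * indicator {0..1} v \<partial>lborel) \<le> ennreal (1 + \<kappa>) * Gc p q + ennreal \<kappa>"
proof -
  \<comment> \<open>Chosen so that \<open>K / (K - 2) - 1 = \<kappa> / 2\<close>, the relative loss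
    in the distance for well separated points.\<close>
  define K where "K = 2 + 4 / \<kappa>"
  have K: "K > 2" using \<kappa> by (simp add: K_def)
  define B where "B = \<bar>ln (2 * K * D)\<bar>"
  \<comment> \<open>The additive error for close points is \<open>B\<close> plus 10, twice the bound
    5 for the inverse square root integral; a kernel value of at least \<open>M\<close> absorbs
    it.\<close>
  define M where "M = (B + 10) / \<kappa>"
  \<comment> \<open>The entries keep the change of the reflected distance below a factor
    \<open>1 + \<kappa> / 2\<close>, keep imaginary parts positive, and force the kernel above
    \<open>M\<close> when \<open>p\<close> and \<open>q\<close> are close.\<close>
  define r0 where "r0 = Min {h * \<kappa> / (2 * D), h / (2 * D), 2 * h * exp (- M) / (K * D)}"
  have r0: "r0 > 0" using \<kappa> h D K by (simp add: r0_def)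
  show ?thesis
  proof (intro exI[of _ r0] conjI r0 allI impI, elim conjE)
    fix r p q z and Z :: "real \<Rightarrow> complex" and s :: real
    assume r: "0 < r" "r < r0" and Imp: "h \<le> Im p" and Imq: "h \<le> Im q" and zp: "cmod (z - p) \<le> D * r"
      and Z: "\<forall>v\<in>{0..1}. cmod (Z v - q) \<le> D * r \<and> r / 2 * \<bar>v - s\<bar> \<le> cmod (z - Z v)"
    have Zq: "cmod (Z v - q) \<le> D * r" and sep: "r / 2 * \<bar>v - s\<bar> \<le> cmod (z - Z v)" if "v \<in> {0..1}" for v
      using Z that by blast+
    have "r < h * \<kappa> / (2 * D)" "r < h / (2 * D)" "r < 2 * h * exp (- M) / (K * D)"
      using r by (auto simp: r0_def)
    hence Dr: "D * r / h < \<kappa> / 2" "D * r < h / 2" "K * D * r < 2 * h * exp (- M)"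
      using \<kappa> h D K by (auto simp: field_simps)
    have pcq: "2 * h \<le> cmod (p - cnj q)" using abs_Im_le_cmod[of "p - cnj q"] Imp Imq by simp
    have zc: "0 < cmod (z - cnj (Z v)) \<and> ln (cmod (z - cnj (Z v))) \<le> ln (cmod (p - cnj q)) + \<kappa> / 2"
      if v: "v \<in> {0..1}" for v
    proof -
      have "\<bar>Im (z - p)\<bar> \<le> D * r" "\<bar>Im (Z v - q)\<bar> \<le> D * r"
        using abs_Im_le_cmod[of "z - p"] zp abs_Im_le_cmod[of "Z v - q"] Zq[OF v] by linarith+
      hence "0 < Im (z - cnj (Z v))" using Imp Imq Dr h by simp
      hence pos: "0 < cmod (z - cnj (Z v))" by (auto simp: complex_eq_iff)
      have e: "z - cnj (Z v) = (p - cnj q) + (z - p) - cnj (Z v - q)" by simp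
      have "cmod (z - cnj (Z v)) \<le> cmod (p - cnj q) + cmod (z - p) + cmod (cnj (Z v - q))"
        by (subst e) (rule order_trans[OF norm_triangle_ineq4 add_right_mono[OF norm_triangle_ineq]])
      also have "\<dots> \<le> cmod (p - cnj q) + 2 * (D * r)"
        using zp Zq[OF v] by (simp only: complex_mod_cnj)
      also have "\<dots> = cmod (p - cnj q) + (2 * h) * (D * r / h)" using h by simp
      \<comment> \<open>The lower bound \<open>2 * h\<close> turns the absolute error into a
        relative one.\<close>
      also have "\<dots> \<le> cmod (p - cnj q) + cmod (p - cnj q) * (D * r / h)"
        using pcq h D r by (intro add_left_mono mult_right_mono) auto
      also have "\<dots> = cmod (p - cnj q) * (1 + D * r / h)" by (simp add: algebra_simps)
      finally have "ln (cmod (z - cnj (Z v))) \<le> ln (cmod (p - cnj q) * (1 + D * r / h))"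
        using pos by (intro ln_mono) auto
      also have "\<dots> = ln (cmod (p - cnj q)) + ln (1 + D * r / h)"
        using pcq h D r by (intro ln_mult_pos) (auto intro!: add_pos_nonneg)
      also have "ln (1 + D * r / h) \<le> D * r / h" using h D r by (intro ln_add_one_self_le_self) auto
      finally show ?thesis using Dr pos by linarith
    qed
    show "(\<integral>\<^sup>+v. Gc z (Z v) * indicator {0..1} v \<partial>lborel) \<le> ennreal (1 + \<kappa>) * Gc p q + ennreal \<kappa>"
    proof (cases "p = q")
      case True
      hence "Gc p q = \<infinity>" using Imp h by (simp add: Gc_def)
      thus ?thesis using \<kappa> by (simp add: ennreal_mult_top)
    next
      case False
      define g where "g = ln (cmod (p - cnj q)) - ln (cmod (p - q))"
      have pq: "0 < cmod (p - q)" using False by simp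
      have pcq0: "0 < cmod (p - cnj q)" using pcq h by linarith
      have Gg: "Gc p q = ennreal g" unfolding g_def using False pcq0 by (intro Gc_eq) auto
      have "cmod (p - q) \<le> cmod (p - cnj q)" using Imp Imq h by (intro cmod_diff_le_cnj) auto
      hence g0: "0 \<le> g" using ln_mono[OF _ pq] by (simp add: g_def)
      have rhs: "ennreal (1 + \<kappa>) * Gc p q + ennreal \<kappa> = ennreal ((1 + \<kappa>) * g + \<kappa>)"
        using g0 \<kappa> by (simp add: Gg ennreal_mult' ennreal_plus)
      show ?thesis
      proof (cases "K * D * r \<le> cmod (p - q)")
        case True
        have "Gc z (Z v) * indicator {0..1} v \<le> ennreal (g + \<kappa>) * indicator {0..1} v" for v
        proof (cases "v \<in> {0..1}")
          case v: True
          have e: "p - q = (z - Z v) - (z - p) + (Z v - q)" by simp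
          have "cmod (p - q) \<le> cmod (z - Z v) + cmod (z - p) + cmod (Z v - q)"
            by (subst e) (rule order_trans[OF norm_triangle_ineq add_right_mono[OF norm_triangle_ineq4]])
          hence "cmod (p - q) - 2 * (D * r) \<le> cmod (z - Z v)" using zp Zq[OF v] by linarith
          moreover have "D * r \<le> cmod (p - q) / K" using True K by (simp add: field_simps)
          ultimately have "cmod (p - q) - 2 * (cmod (p - q) / K) \<le> cmod (z - Z v)" by linarith
          moreover have "cmod (p - q) - 2 * (cmod (p - q) / K) = cmod (p - q) * ((K - 2) / K)"
            using K by (simp add: field_simps)
          ultimately have low: "cmod (p - q) * ((K - 2) / K) \<le> cmod (z - Z v)" by simp
          have c0: "0 < cmod (p - q) * ((K - 2) / K)" using K pq by simp
          hence ne: "z \<noteq> Z v" using low by auto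
          have "ln (cmod (p - q) * ((K - 2) / K)) \<le> ln (cmod (z - Z v))" using low c0 by (intro ln_mono) auto
          moreover have "ln (cmod (p - q) * ((K - 2) / K)) = ln (cmod (p - q)) - ln (K / (K - 2))"
            using pq K by (simp add: ln_mult ln_div)
          moreover have "ln (K / (K - 2)) \<le> K / (K - 2) - 1" using K by (intro ln_le_minus_one) simp
          moreover have "K / (K - 2) - 1 = \<kappa> / 2" using \<kappa> by (simp add: K_def field_simps)
          ultimately have "ln (cmod (z - cnj (Z v))) - ln (cmod (z - Z v)) \<le> g + \<kappa>"
            using zc[OF v, THEN conjunct2] unfolding g_def by linarith
          moreover have "z \<noteq> cnj (Z v)" using zc[OF v] by auto
          ultimately show ?thesis using ne v by (simp add: Gc_eq ennreal_leI)
        qed simp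
        hence "(\<integral>\<^sup>+v. Gc z (Z v) * indicator {0..1} v \<partial>lborel) \<le> (\<integral>\<^sup>+v. ennreal (g + \<kappa>) * indicator {0..1::real} v \<partial>lborel)"
          by (rule nn_integral_mono)
        also have "\<dots> = ennreal (g + \<kappa>)" by (rule nn_integral_unit_const)
        also have "\<dots> \<le> ennreal ((1 + \<kappa>) * g + \<kappa>)" using g0 \<kappa> by (intro ennreal_leI) (simp add: algebra_simps)
        finally show ?thesis by (simp only: rhs)
      next
        case near: False
        define c where "c = g + \<kappa> / 2 + B"
        have c0: "0 \<le> c" using g0 \<kappa> by (simp add: c_def B_def)
        have "AE v in lborel. Gc z (Z v) * indicator {0..1} v
          \<le> ennreal c * indicator {0..1} v + 2 * (ennreal (1 / sqrt \<bar>v - s\<bar>) * indicator {0..1} v)"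
          using AE_lborel_singleton[of s]
        proof eventually_elim
          case (elim v)
          show ?case
          proof (cases "v \<in> {0..1}")
            case v: True
            have y0: "0 < \<bar>v - s\<bar>" using elim by simp
            have low0: "0 < r / 2 * \<bar>v - s\<bar>" using r y0 by simp
            hence ne: "z \<noteq> Z v" using sep[OF v] by auto
            have "ln (r / 2 * \<bar>v - s\<bar>) \<le> ln (cmod (z - Z v))" using sep[OF v] low0 by (intro ln_mono) auto
            moreover have "ln (r / 2 * \<bar>v - s\<bar>) = ln (r / 2) + ln \<bar>v - s\<bar>" using r y0 by (intro ln_mult_pos) auto
            moreover have "- ln \<bar>v - s\<bar> \<le> 2 * (1 / sqrt \<bar>v - s\<bar>)"
            proof -
              have "- ln \<bar>v - s\<bar> = 2 * ln (1 / sqrt \<bar>v - s\<bar>)" using y0 by (simp add: ln_div ln_sqrt)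
              also have "\<dots> \<le> 2 * (1 / sqrt \<bar>v - s\<bar>)"
                using ln_le_minus_one[of "1 / sqrt \<bar>v - s\<bar>"] y0 by simp
              finally show ?thesis .
            qed
            moreover have "- ln (r / 2) \<le> ln (2 * K * D) - ln (cmod (p - q))"
            proof -
              have "cmod (p - q) / (2 * K * D) \<le> r / 2" using near K D by (simp add: field_simps)
              hence "ln (cmod (p - q) / (2 * K * D)) \<le> ln (r / 2)" using pq K D by (intro ln_mono) auto
              thus ?thesis using pq K D by (simp add: ln_div)
            qed
            ultimately have "ln (cmod (z - cnj (Z v))) - ln (cmod (z - Z v)) \<le> c + 2 * (1 / sqrt \<bar>v - s\<bar>)"
              using zc[OF v, THEN conjunct2] abs_ge_self[of "ln (2 * K * D)"]
              unfolding g_def c_def B_def by linarith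
            moreover have "z \<noteq> cnj (Z v)" using zc[OF v] by auto
            ultimately have "Gc z (Z v) \<le> ennreal (c + 2 * (1 / sqrt \<bar>v - s\<bar>))"
              using ne by (simp add: Gc_eq ennreal_leI)
            also have "\<dots> = ennreal c + 2 * ennreal (1 / sqrt \<bar>v - s\<bar>)"
              using c0 by (simp add: ennreal_plus ennreal_mult' del: times_divide_eq_right)
            finally show ?thesis using v by simp
          qed simp
        qed
        hence "(\<integral>\<^sup>+v. Gc z (Z v) * indicator {0..1} v \<partial>lborel)
          \<le> (\<integral>\<^sup>+v. ennreal c * indicator {0..1} v + 2 * (ennreal (1 / sqrt \<bar>v - s\<bar>) * indicator {0..1} v) \<partial>lborel)"
          by (rule nn_integral_mono_AE)
        also have "\<dots> = ennreal c + 2 * (\<integral>\<^sup>+v. ennreal (1 / sqrt \<bar>v - s\<bar>) * indicator {0..1} v \<partial>lborel)"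
          by (subst nn_integral_add) (auto simp: nn_integral_cmult)
        also have "\<dots> \<le> ennreal c + 2 * 5"
          by (intro add_left_mono mult_left_mono nn_integral_inverse_sqrt_le) auto
        also have "\<dots> = ennreal (c + 10)" using c0 by (simp add: ennreal_plus)
        also have "\<dots> \<le> ennreal ((1 + \<kappa>) * g + \<kappa>)"
        proof (rule ennreal_leI)
          have "M \<le> g"
          proof -
            have "cmod (p - q) \<le> 2 * h * exp (- M)" using near Dr by linarith
            hence "ln (cmod (p - q)) \<le> ln (2 * h * exp (- M))" using pq by (intro ln_mono) auto
            also have "\<dots> = ln (2 * h) - M" using h by (simp add: ln_mult)
            finally have "ln (cmod (p - q)) \<le> ln (2 * h) - M" .
            moreover have "ln (2 * h) \<le> ln (cmod (p - cnj q))" using pcq h by (intro ln_mono) auto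
            ultimately show ?thesis by (simp add: g_def)
          qed
          hence "\<kappa> * M \<le> \<kappa> * g" using \<kappa> by (intro mult_left_mono) auto
          moreover have "\<kappa> * M = B + 10" using \<kappa> by (simp add: M_def)
          moreover have "(1 + \<kappa>) * g = g + \<kappa> * g" by (simp add: distrib_right)
          ultimately show "c + 10 \<le> (1 + \<kappa>) * g + \<kappa>" using \<kappa> unfolding c_def by linarith
        qed
        finally show ?thesis by (simp only: rhs)
      qed
    qed
  qed
qed

section \<open>The Green kernel near a boundary point\<close>

text \<open>Dividing by \<open>exp x\<close> symmetrises the right side to a square of
  \<open>exp (x / 2) - exp (- (x / 2))\<close>, which dominates \<open>x / 2\<close> in absolute
  value.\<close>

lemma exp_diff_sq_ge:
  fixes x :: real
  shows "exp x * x\<^sup>2 \<le> 4 * (exp x - 1)\<^sup>2"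
proof -
  have *: "y \<le> exp y - exp (- y)" if "y \<ge> 0" for y :: real
    using exp_ge_add_one_self[of y] exp_le_one_iff[of "-y"] that by linarith
  have "\<bar>x / 2\<bar> \<le> \<bar>exp (x / 2) - exp (- (x / 2))\<bar>"
    using *[of "x / 2"] *[of "- (x / 2)"] by (cases "x \<ge> 0") auto
  hence "(x / 2)\<^sup>2 \<le> (exp (x / 2) - exp (- (x / 2)))\<^sup>2" by (simp only: abs_le_square_iff)
  hence "exp x * (x / 2)\<^sup>2 \<le> exp x * (exp (x / 2) - exp (- (x / 2)))\<^sup>2" by (intro mult_left_mono) auto
  also have "\<dots> = (exp (x / 2) * (exp (x / 2) - exp (- (x / 2))))\<^sup>2"
    by (simp add: power_mult_distrib power2_eq_square[of "exp (x / 2)"] exp_add[symmetric])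
  also have "exp (x / 2) * (exp (x / 2) - exp (- (x / 2))) = exp x - 1"
    by (simp add: right_diff_distrib exp_add[symmetric])
  finally show ?thesis by (simp add: power_divide)
qed

text \<open>The kernel depends only on \<open>Im z * Im w / \<bar>z - w\<bar>\<^sup>2\<close>. With
  radii \<open>\<rho>\<close> and \<open>s\<close> about \<open>a\<close> this is bounded by a
  multiple of \<open>\<rho> * s / (\<rho> - s)\<^sup>2\<close>, a function of the logarithm
  \<open>x\<close> of their ratio. The resulting singularity in \<open>u - v\<close> is integrable,
  with a factor that tends to 0 as \<open>\<Theta>\<close> grows.\<close>

lemma green_kernel_boundary:
  fixes a D h \<Theta> u v :: real
  assumes pos: "0 < D" "0 < h" "0 < \<Theta>" and uv: "u \<noteq> v" and Im: "0 \<le> Im z" "0 \<le> Im w"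
    and z: "cmod (z - of_real a) \<le> D * (h * exp (- \<Theta> * u))"
    and w: "cmod (w - of_real a) \<le> D * (h * exp (- \<Theta> * v))"
    and zw: "\<bar>h * exp (- \<Theta> * u) - h * exp (- \<Theta> * v)\<bar> / 2 \<le> cmod (z - w)"
  shows "Gc z w \<le> ennreal (2 * sqrt (8 * D / \<Theta>)) * ennreal (1 / sqrt \<bar>u - v\<bar>)"
proof -
  define \<rho> where "\<rho> = h * exp (- \<Theta> * u)"
  define s where "s = h * exp (- \<Theta> * v)"
  have ps: "0 < \<rho>" "0 < s" using pos by (auto simp: \<rho>_def s_def)
  define x where "x = \<Theta> * (u - v)"
  have x0: "x \<noteq> 0" using pos uv by (simp add: x_def)
  have sx: "s = \<rho> * exp x" by (simp add: s_def \<rho>_def x_def exp_add[symmetric] algebra_simps)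
  have "\<rho> * s * x\<^sup>2 = \<rho>\<^sup>2 * (exp x * x\<^sup>2)" by (simp add: sx power2_eq_square)
  also have "\<dots> \<le> \<rho>\<^sup>2 * (4 * (exp x - 1)\<^sup>2)" by (intro mult_left_mono exp_diff_sq_ge) auto
  also have "\<dots> = 4 * (\<rho> - s)\<^sup>2" by (simp add: sx power2_eq_square algebra_simps)
  finally have key: "\<rho> * s * x\<^sup>2 \<le> 4 * (\<rho> - s)\<^sup>2" .
  hence ne: "\<rho> \<noteq> s" using ps x0 by (auto simp: not_le[symmetric] mult_le_0_iff)
  hence "0 < \<bar>\<rho> - s\<bar> / 2" by simp
  hence zw0: "0 < cmod (z - w)" using zw unfolding \<rho>_def s_def by linarith
  have zw2: "(\<rho> - s)\<^sup>2 \<le> 4 * (cmod (z - w))\<^sup>2"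
  proof -
    have "\<bar>\<rho> - s\<bar> \<le> 2 * cmod (z - w)" using zw by (simp add: \<rho>_def s_def)
    hence "\<bar>\<rho> - s\<bar>\<^sup>2 \<le> (2 * cmod (z - w))\<^sup>2" by (intro power_mono) auto
    thus ?thesis by (simp add: power_mult_distrib)
  qed
  have "Im z \<le> D * \<rho>" "Im w \<le> D * s"
    using abs_Im_le_cmod[of "z - of_real a"] abs_Im_le_cmod[of "w - of_real a"] z w by (auto simp: \<rho>_def s_def)
  hence "Im z * Im w \<le> (D * \<rho>) * (D * s)" using Im pos ps by (intro mult_mono) auto
  hence "4 * Im z * Im w * x\<^sup>2 \<le> 4 * D\<^sup>2 * (\<rho> * s * x\<^sup>2)"
    using mult_right_mono[of "Im z * Im w" "(D * \<rho>) * (D * s)" "4 * x\<^sup>2"] by (simp add: power2_eq_square mult_ac)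
  also have "\<dots> \<le> 4 * D\<^sup>2 * (4 * (4 * (cmod (z - w))\<^sup>2))"
    using key zw2 by (intro mult_left_mono) auto
  finally have "4 * Im z * Im w * x\<^sup>2 \<le> 64 * D\<^sup>2 * (cmod (z - w))\<^sup>2" by simp
  hence ratio: "4 * Im z * Im w / (cmod (z - w))\<^sup>2 \<le> 64 * D\<^sup>2 / x\<^sup>2"
    using x0 zw0 by (simp add: field_simps)
  \<comment> \<open>The fourth power of \<open>\<omega>\<close> is the bound for the ratio, while
    \<open>\<omega>\<close> itself has only an inverse square root singularity;
    \<open>1 + \<omega> ^ 4 \<le> (1 + \<omega>) ^ 4\<close> lets the logarithm extract it.\<close>
  define \<omega> where "\<omega> = sqrt (8 * D / \<bar>x\<bar>)"
  have om0: "0 \<le> \<omega>" using pos by (simp add: \<omega>_def)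
  have "\<omega>\<^sup>2 = 8 * D / \<bar>x\<bar>" using pos by (simp add: \<omega>_def)
  hence om4: "\<omega> ^ 4 = 64 * D\<^sup>2 / x\<^sup>2"
    by (simp add: power2_eq_square power4_eq_xxxx mult.assoc[symmetric]) (simp add: mult.assoc)
  define c where "c = cmod (z - cnj w)"
  have "c\<^sup>2 / (cmod (z - w))\<^sup>2 = 1 + 4 * Im z * Im w / (cmod (z - w))\<^sup>2"
    unfolding c_def cmod_diff_cnj_sq using zw0 by (simp add: add_divide_distrib)
  also have "\<dots> \<le> 1 + \<omega> ^ 4" using ratio by (simp add: om4)
  also have "\<dots> \<le> (1 + \<omega>) ^ 4"
  proof -
    have "(1 + \<omega>) ^ 4 = 1 + \<omega> ^ 4 + (4 * \<omega> + 6 * \<omega>\<^sup>2 + 4 * \<omega> ^ 3)"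
      by (simp add: power2_eq_square power3_eq_cube power4_eq_xxxx algebra_simps)
    thus ?thesis using om0 by simp
  qed
  finally have le4: "c\<^sup>2 / (cmod (z - w))\<^sup>2 \<le> (1 + \<omega>) ^ 4" .
  have c_pos: "0 < c" using cmod_diff_le_cnj[OF Im] zw0 unfolding c_def by linarith
  have "2 * ln (c / cmod (z - w)) = ln ((c / cmod (z - w))\<^sup>2)"
    using c_pos zw0 by (simp add: ln_realpow)
  also have "\<dots> \<le> ln ((1 + \<omega>) ^ 4)"
    using le4 c_pos zw0 by (intro ln_mono) (auto simp: power_divide)
  also have "\<dots> = 4 * ln (1 + \<omega>)" using om0 by (simp add: ln_realpow)
  also have "\<dots> \<le> 4 * \<omega>" using ln_add_one_self_le_self[OF om0] by simp
  finally have "ln (c / cmod (z - w)) \<le> 2 * \<omega>" by simp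
  also have "2 * \<omega> = (2 * sqrt (8 * D / \<Theta>)) * (1 / sqrt \<bar>u - v\<bar>)"
    using pos by (simp add: \<omega>_def x_def abs_mult real_sqrt_divide real_sqrt_mult)
  finally have "ennreal (ln (c / cmod (z - w))) \<le> ennreal ((2 * sqrt (8 * D / \<Theta>)) * (1 / sqrt \<bar>u - v\<bar>))"
    by (rule ennreal_leI)
  also have "\<dots> = ennreal (2 * sqrt (8 * D / \<Theta>)) * ennreal (1 / sqrt \<bar>u - v\<bar>)"
    using pos by (intro ennreal_mult) auto
  finally show ?thesis using zw0 by (simp add: Gc_def c_def)
qed

section \<open>Transport of measures\<close>

definition unif01 :: "real measure" where
  "unif01 = density lborel (indicator {0..1})"

lemma sets_unif01 [measurable_cong, simp]: "sets unif01 = sets borel"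
  by (simp add: unif01_def)

lemma space_unif01 [simp]: "space unif01 = UNIV"
  by (simp add: unif01_def)

lemma nn_integral_unif01:
  assumes "f \<in> borel_measurable borel"
  shows "(\<integral>\<^sup>+u. f u \<partial>unif01) = (\<integral>\<^sup>+u. f u * indicator {0..1} u \<partial>lborel)"
  unfolding unif01_def using assms by (subst nn_integral_density) (auto simp: mult.commute)

lemma emeasure_unif01_UNIV: "emeasure unif01 UNIV = 1"
  unfolding unif01_def by (subst emeasure_density) auto

lemma finite_measure_unif01: "finite_measure unif01"
  by (rule finite_measureI) (simp add: emeasure_unif01_UNIV)

lemma AE_unif01: "AE u in unif01. u \<in> {0..1}"
  unfolding unif01_def by (subst AE_density) (auto simp: indicator_def)

lemma distr_pair_unif01_fst:
  assumes "finite_measure \<mu>"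
  shows "distr (\<mu> \<Otimes>\<^sub>M unif01) \<mu> fst = \<mu>"
proof (rule measure_eqI)
  interpret U: finite_measure unif01 by (rule finite_measure_unif01)
  fix X assume "X \<in> sets (distr (\<mu> \<Otimes>\<^sub>M unif01) \<mu> fst)"
  hence X: "X \<in> sets \<mu>" by simp
  have "emeasure (distr (\<mu> \<Otimes>\<^sub>M unif01) \<mu> fst) X = emeasure (\<mu> \<Otimes>\<^sub>M unif01) (X \<times> UNIV)"
    using X sets.sets_into_space[OF X]
    by (subst emeasure_distr) (auto simp: space_pair_measure intro!: arg_cong[where f="emeasure _"])
  also have "\<dots> = emeasure \<mu> X"
    using X by (subst U.emeasure_pair_measure_Times) (auto simp: emeasure_unif01_UNIV)
  finally show "emeasure (distr (\<mu> \<Otimes>\<^sub>M unif01) \<mu> fst) X = emeasure \<mu> X" .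
qed simp

lemma Gk_measurable_snd: "p \<in> Kbar A \<Longrightarrow> Gk p \<in> borel_measurable (Kborel A)"
  using measurable_compose[OF measurable_Pair1' Gk_measurable[of A], of p] by simp

text \<open>The competitor is the image of \<open>\<mu> \<Otimes>\<^sub>M unif01\<close> under
  \<open>T\<close>. Averaging over the parameter \<open>v\<close> of one point suffices, whatever
  the parameter \<open>u\<close> of the other. The error collects \<open>\<kappa>\<close> times the
  energy, the additive \<open>\<kappa>\<close> over all pairs, and \<open>\<kappa>\<close> over all
  points for the field, which \<open>Ephi\<close> counts twice.\<close>

lemma transport_to_continuum:
  fixes T :: "kpt \<times> real \<Rightarrow> kpt"
  assumes F: "F \<in> FF A"
    and fin: "finite_measure \<mu>" and sets_\<mu>: "sets \<mu> = sets (Kborel A)"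
    and en: "energy \<mu> < \<infinity>" and int: "integrable \<mu> (phik A \<rho>0 x t)"
    and T: "T \<in> measurable (\<mu> \<Otimes>\<^sub>M unif01) (Kborel A)" and TF: "\<And>y. T y \<in> F"
    and S: "AE p in \<mu>. p \<in> S" and \<kappa>: "0 \<le> \<kappa>"
    and ker: "\<And>p q u. p \<in> S \<Longrightarrow> q \<in> S \<Longrightarrow> u \<in> {0..1} \<Longrightarrow>
      (\<integral>\<^sup>+v. Gk (T (p, u)) (T (q, v)) * indicator {0..1} v \<partial>lborel) \<le> ennreal (1 + \<kappa>) * Gk p q + ennreal \<kappa>"
    and phi: "\<And>p u. p \<in> S \<Longrightarrow> u \<in> {0..1} \<Longrightarrow> \<bar>phik A \<rho>0 x t (T (p, u)) - phik A \<rho>0 x t p\<bar> \<le> \<kappa>"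
  obtains \<nu> where "\<nu> \<in> MF A \<rho>0 x t F"
    "Ephi A \<rho>0 x t \<nu> \<le> Ephi A \<rho>0 x t \<mu>
       + \<kappa> * (enn2real (energy \<mu>) + (measure \<mu> (space \<mu>))\<^sup>2 + 2 * measure \<mu> (space \<mu>))"
proof -
  interpret \<mu>: finite_measure \<mu> by (rule fin)
  interpret U: finite_measure unif01 by (rule finite_measure_unif01)
  let ?P = "\<mu> \<Otimes>\<^sub>M unif01" and ?f = "phik A \<rho>0 x t"
  define m where "m = measure \<mu> (space \<mu>)"
  have m0: "0 \<le> m" by (simp add: m_def)
  have em: "emeasure \<mu> (space \<mu>) = ennreal m" by (simp add: m_def \<mu>.emeasure_eq_measure)
  interpret P: finite_measure ?P
    by (rule finite_measureI)
       (simp add: space_pair_measure U.emeasure_pair_measure_Times em emeasure_unif01_UNIV)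
  have sp: "space \<mu> = Kbar A" using sets_eq_imp_space_eq[OF sets_\<mu>] by simp
  note [measurable_cong] = sets_\<mu>
  note [measurable] = T
  have f_meas [measurable]: "?f \<in> borel_measurable (Kborel A)"
    using borel_measurable_integrable[OF int] by (simp cong: measurable_cong_sets add: sets_\<mu>)
  have TK: "T y \<in> Kbar A" for y by (rule subsetD[OF FF_subset[OF F] TF])
  define \<nu> where "\<nu> = distr ?P (Kborel A) T"
  have sets_\<nu>: "sets \<nu> = sets (Kborel A)" by (simp add: \<nu>_def)
  have AEfst: "AE y in ?P. fst y \<in> S"
  proof (rule AE_distrD[of fst ?P \<mu>])
    show "AE p in distr ?P \<mu> fst. p \<in> S" unfolding distr_pair_unif01_fst[OF fin] by (rule S)
  qed simp
  have AEsnd: "AE y in ?P. snd y \<in> {0..1}"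
  proof (rule pair_sigma_finite.AE_pair_measure)
    show "pair_sigma_finite \<mu> unif01" ..
    show "{y \<in> space ?P. snd y \<in> {0..1}} \<in> sets ?P" by measurable
    show "AE p in \<mu>. AE u in unif01. snd (p, u) \<in> {0..1}" using AE_unif01 by simp
  qed
  have Gpair [measurable]: "(\<lambda>(P, y). Gk P (T y)) \<in> borel_measurable (Kborel A \<Otimes>\<^sub>M ?P)"
  proof -
    have "(\<lambda>z. (fst z, T (snd z))) \<in> measurable (Kborel A \<Otimes>\<^sub>M ?P) (Kborel A \<Otimes>\<^sub>M Kborel A)"
      by measurable
    from measurable_compose[OF this Gk_measurable] show ?thesis by (simp add: split_beta')
  qed
  have e_meas [measurable]: "(\<lambda>P. \<integral>\<^sup>+y. Gk P (T y) \<partial>?P) \<in> borel_measurable (Kborel A)"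
    by (rule P.borel_measurable_nn_integral[OF Gpair])
  define g where "g p = ennreal (1 + \<kappa>) * (\<integral>\<^sup>+q. Gk p q \<partial>\<mu>) + ennreal \<kappa> * ennreal m" for p
  have GG [measurable]: "(\<lambda>(p, q). Gk p q) \<in> borel_measurable (Kborel A \<Otimes>\<^sub>M \<mu>)" by measurable
  have i_meas [measurable]: "(\<lambda>p. \<integral>\<^sup>+q. Gk p q \<partial>\<mu>) \<in> borel_measurable (Kborel A)"
    by (rule \<mu>.borel_measurable_nn_integral) measurable
  have inner: "(\<integral>\<^sup>+y'. Gk (T y) (T y') \<partial>?P) \<le> g (fst y)" if y: "fst y \<in> S" "snd y \<in> {0..1}" "fst y \<in> Kbar A" for y
  proof -
    have mv: "(\<lambda>y'. Gk (T y) (T y')) \<in> borel_measurable ?P"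
      using measurable_compose[OF T Gk_measurable_snd[OF TK]] .
    have mq: "(\<lambda>v. Gk (T y) (T (q, v))) \<in> borel_measurable borel" if "q \<in> Kbar A" for q
      using measurable_compose[OF measurable_Pair1' mv, of q] that sp by simp
    have "(\<integral>\<^sup>+y'. Gk (T y) (T y') \<partial>?P) = (\<integral>\<^sup>+q. \<integral>\<^sup>+v. Gk (T y) (T (q, v)) \<partial>unif01 \<partial>\<mu>)"
      by (rule U.nn_integral_fst[OF mv, symmetric])
    also have "\<dots> \<le> (\<integral>\<^sup>+q. ennreal (1 + \<kappa>) * Gk (fst y) q + ennreal \<kappa> \<partial>\<mu>)"
    proof (rule nn_integral_mono_AE)
      show "AE q in \<mu>. (\<integral>\<^sup>+v. Gk (T y) (T (q, v)) \<partial>unif01) \<le> ennreal (1 + \<kappa>) * Gk (fst y) q + ennreal \<kappa>"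
        using S AE_space
      proof eventually_elim
        case (elim q)
        thus ?case using ker[of "fst y" q "snd y"] y mq[of q] sp by (simp add: nn_integral_unif01)
      qed
    qed
    also have "\<dots> = g (fst y)"
    proof -
      have [measurable]: "Gk (fst y) \<in> borel_measurable \<mu>"
        using Gk_measurable_snd[OF y(3)] by (simp cong: measurable_cong_sets add: sets_\<mu>)
      show ?thesis unfolding g_def by (subst nn_integral_add) (auto simp: nn_integral_cmult em)
    qed
    finally show ?thesis .
  qed
  have g_meas [measurable]: "g \<in> borel_measurable (Kborel A)" unfolding g_def[abs_def] by measurable
  have "energy \<nu> = (\<integral>\<^sup>+P. (\<integral>\<^sup>+y. Gk P (T y) \<partial>?P) \<partial>\<nu>)"
    unfolding energy_def
  proof (rule nn_integral_cong)
    fix P assume "P \<in> space \<nu>"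
    hence "P \<in> Kbar A" by (simp add: \<nu>_def)
    thus "(\<integral>\<^sup>+q. Gk P q \<partial>\<nu>) = (\<integral>\<^sup>+y. Gk P (T y) \<partial>?P)"
      unfolding \<nu>_def by (intro nn_integral_distr[OF T]) (simp add: Gk_measurable_snd)
  qed
  also have "\<dots> = (\<integral>\<^sup>+y. (\<integral>\<^sup>+y'. Gk (T y) (T y') \<partial>?P) \<partial>?P)"
    unfolding \<nu>_def by (rule nn_integral_distr[OF T]) (simp add: e_meas)
  also have "\<dots> \<le> (\<integral>\<^sup>+y. g (fst y) \<partial>?P)"
  proof (rule nn_integral_mono_AE)
    show "AE y in ?P. (\<integral>\<^sup>+y'. Gk (T y) (T y') \<partial>?P) \<le> g (fst y)"
      using AEfst AEsnd AE_space
    proof eventually_elim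
      case (elim y)
      thus ?case by (intro inner) (auto simp: space_pair_measure sp)
    qed
  qed
  \<comment> \<open>The bound no longer depends on the uniform parameter, and the first marginal of
    the product is \<open>\<mu>\<close>.\<close>
  also have "\<dots> = (\<integral>\<^sup>+p. g p \<partial>distr ?P \<mu> fst)"
    by (rule nn_integral_distr[symmetric]) measurable
  also have "\<dots> = (\<integral>\<^sup>+p. g p \<partial>\<mu>)" unfolding distr_pair_unif01_fst[OF fin] ..
  also have "\<dots> = ennreal (1 + \<kappa>) * energy \<mu> + ennreal \<kappa> * ennreal m * ennreal m"
    unfolding g_def energy_def by (subst nn_integral_add) (auto simp: nn_integral_cmult em)
  finally have en_le: "energy \<nu> \<le> ennreal (1 + \<kappa>) * energy \<mu> + ennreal \<kappa> * ennreal m * ennreal m" .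
  define E where "E = enn2real (energy \<mu>)"
  have E: "energy \<mu> = ennreal E" "0 \<le> E" using en by (auto simp: E_def)
  have "ennreal (1 + \<kappa>) * energy \<mu> + ennreal \<kappa> * ennreal m * ennreal m = ennreal ((1 + \<kappa>) * E + \<kappa> * m * m)"
    using E m0 \<kappa> by (simp add: ennreal_mult' ennreal_plus)
  hence en2: "energy \<nu> \<le> ennreal ((1 + \<kappa>) * E + \<kappa> * m * m)" using en_le by simp
  have enfin: "energy \<nu> < \<infinity>" using en2 by (simp add: order_le_less_trans)
  have nn: "0 \<le> (1 + \<kappa>) * E + \<kappa> * m * m" using E m0 \<kappa> by simp
  have enr: "enn2real (energy \<nu>) \<le> (1 + \<kappa>) * E + \<kappa> * m * m"
    using enn2real_mono[OF en2] nn by simp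
  have ifst: "integrable ?P (\<lambda>y. ?f (fst y))"
  proof (rule integrable_distr[of fst ?P \<mu>])
    show "integrable (distr ?P \<mu> fst) ?f" unfolding distr_pair_unif01_fst[OF fin] by (rule int)
  qed simp
  have ibd: "integrable ?P (\<lambda>y. ?f (fst y) + \<kappa>)" using ifst by simp
  have close: "AE y in ?P. \<bar>?f (T y) - ?f (fst y)\<bar> \<le> \<kappa>"
    using AEfst AEsnd by eventually_elim (use phi in fastforce)
  have iT: "integrable ?P (\<lambda>y. ?f (T y))"
  proof (rule Bochner_Integration.integrable_bound[of _ "\<lambda>y. \<bar>?f (fst y)\<bar> + \<kappa>"])
    show "AE y in ?P. norm (?f (T y)) \<le> norm (\<bar>?f (fst y)\<bar> + \<kappa>)" using close by eventually_elim auto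
  qed (use ifst in auto)
  have i\<nu>: "integrable \<nu> ?f" unfolding \<nu>_def by (subst integrable_distr_eq) (auto simp: iT)
  have "(LINT p|\<nu>. ?f p) = (LINT y|?P. ?f (T y))" unfolding \<nu>_def by (rule integral_distr) auto
  also have "\<dots> \<le> (LINT y|?P. ?f (fst y) + \<kappa>)"
  proof (rule integral_mono_AE[OF iT ibd])
    show "AE y in ?P. ?f (T y) \<le> ?f (fst y) + \<kappa>" using close by eventually_elim auto
  qed
  also have "\<dots> = (LINT y|?P. ?f (fst y)) + \<kappa> * measure ?P (space ?P)"
    using ifst by simp
  also have "(LINT y|?P. ?f (fst y)) = (LINT p|\<mu>. ?f p)"
    using integral_distr[of fst ?P \<mu> ?f] borel_measurable_integrable[OF int]
    unfolding distr_pair_unif01_fst[OF fin] by simp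
  also have "measure ?P (space ?P) = m"
    by (simp add: measure_def space_pair_measure U.emeasure_pair_measure_Times emeasure_unif01_UNIV m_def)
  finally have phi_le: "(LINT p|\<nu>. ?f p) \<le> (LINT p|\<mu>. ?f p) + \<kappa> * m" .
  have "emeasure \<nu> (Kbar A - F) = emeasure ?P (T -` (Kbar A - F) \<inter> space ?P)"
    unfolding \<nu>_def using sets.compl_sets[OF FF_in_sets[OF F]] by (intro emeasure_distr T) simp
  also have "T -` (Kbar A - F) \<inter> space ?P = {}" using TF by auto
  finally have "emeasure \<nu> (Kbar A - F) = 0" by simp
  hence "\<nu> \<in> MF A \<rho>0 x t F" using sets_\<nu> enfin i\<nu> by (simp add: MF_def MM_def)
  moreover have "Ephi A \<rho>0 x t \<nu> \<le> Ephi A \<rho>0 x t \<mu> + \<kappa> * (enn2real (energy \<mu>) + (measure \<mu> (space \<mu>))\<^sup>2 + 2 * measure \<mu> (space \<mu>))"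
    using enr phi_le unfolding Ephi_def E_def[symmetric] m_def[symmetric]
    by (simp add: algebra_simps power2_eq_square)
  ultimately show thesis using that by blast
qed

section \<open>Transport near a boundary point and in the interior\<close>

lemma zof_eq_Some:
  assumes "zof p = Some w"
  shows "p \<noteq> KInf" "kz p = w" "phik A \<rho>0 x t p = phi A \<rho>0 x t w"
  using assms by (auto simp: kz_def phik_def)

lemma Kbar_Im_nonneg: "p \<in> Kbar A \<Longrightarrow> zof p = Some w \<Longrightarrow> 0 \<le> Im w"
  by (auto simp: Kbar_def on_slit_def)

lemma Gk_zof: "zof p = Some z \<Longrightarrow> zof q = Some w \<Longrightarrow> Gk p q = Gc z w"
  by (simp add: Gk_def)

text \<open>Reverse triangle inequality: points on different chordal circles about \<open>b\<close>
  are separated. This is the only spreading of the points of \<open>F\<close> that the kernel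
  estimates need.\<close>

lemma chord_radius_diff_le: "\<bar>chord (Some z) b - chord (Some w) b\<bar> / 2 \<le> cmod (z - w)"
proof -
  have "\<bar>chord (Some z) b - chord (Some w) b\<bar> \<le> 2 * cmod (z - w)"
    using chord_triangle[of "Some z" b "Some w"] chord_triangle[of "Some w" b "Some z"]
      chord_commute[of "Some w" "Some z"] chord_Some_le[of z w] by (intro abs_leI) linarith+
  thus ?thesis by simp
qed

lemma energy_point_mass:
  assumes "Gk p p = 0" "AE q in \<mu>. q = p"
  shows "energy \<mu> = 0"
proof -
  have "energy \<mu> = (\<integral>\<^sup>+q. 0 \<partial>\<mu>)"
    unfolding energy_def
  proof (rule nn_integral_cong_AE)
    show "AE q in \<mu>. (\<integral>\<^sup>+q'. Gk q q' \<partial>\<mu>) = 0"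
      using assms(2)
    proof eventually_elim
      case (elim q)
      have "(\<integral>\<^sup>+q'. Gk q q' \<partial>\<mu>) = (\<integral>\<^sup>+q'. 0 \<partial>\<mu>)"
      proof (rule nn_integral_cong_AE)
        show "AE q' in \<mu>. Gk q q' = 0" using assms(2) by eventually_elim (use elim assms(1) in simp)
      qed
      thus ?case by simp
    qed
  qed
  thus ?thesis by simp
qed

text \<open>At a boundary point \<open>a\<close> with \<open>\<phi> a < 0\<close> a point mass costs no energy. Near \<open>a\<close> it is imitated on
  \<open>F\<close> by a measure spread uniformly over the logarithms of the distances to \<open>a\<close>: by scaling, the
  energy of that measure tends to 0 as the number of available scales grows.\<close>
lemma boundary_case:
  fixes A x t a c :: real
  assumes F0: "F0 \<in> FF A" and a: "KPt (of_real a) False \<in> F0" "a \<noteq> 0"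
    and meas: "phik A \<rho>0 x t \<in> borel_measurable (Kborel A)"
    and cont: "continuous_on {z. 0 \<le> Im z} (phi A \<rho>0 x t)"
    and neg: "phi A \<rho>0 x t (of_real a) < 0"
  shows "\<exists>\<delta>>0. \<forall>F\<in>FF A. hausd A F F0 < \<delta> \<longrightarrow> (\<exists>\<nu>\<in>MF A \<rho>0 x t F. Ephi A \<rho>0 x t \<nu> < c)"
proof -
  let ?phi = "phi A \<rho>0 x t"
  define pa where "pa = KPt (of_real a) False"
  have zpa: "zof pa = Some (of_real a)" by (simp add: pa_def)
  have paK: "pa \<in> Kbar A" using a(1) FF_subset[OF F0] by (auto simp: pa_def)
  \<comment> \<open>The mass for which twice the field integral is
    \<open>- (\<bar>c\<bar> + 2)\<close>. With the next choice of \<open>\<kappa>\<close> the total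
    transport error is 1, so the result stays below \<open>c\<close>.\<close>
  define m where "m = (\<bar>c\<bar> + 2) / (2 * \<bar>?phi (of_real a)\<bar>)"
  have m: "0 < m" unfolding m_def using neg by (intro divide_pos_pos) auto
  have mphi: "2 * (m * ?phi (of_real a)) = - (\<bar>c\<bar> + 2)" using neg by (simp add: m_def field_simps)
  define \<kappa> where "\<kappa> = 1 / (m\<^sup>2 + 2 * m)"
  have \<kappa>: "0 < \<kappa>" "\<kappa> * (m\<^sup>2 + 2 * m) = 1" using m by (auto simp: \<kappa>_def add_pos_pos less_imp_neq[symmetric])
  obtain d where d: "d > 0" "\<And>z. 0 \<le> Im z \<Longrightarrow> cmod (z - of_real a) < d \<Longrightarrow> \<bar>?phi z - ?phi (of_real a)\<bar> < \<kappa>"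
  proof -
    have "complex_of_real a \<in> {z. 0 \<le> Im z}" by simp
    from cont[unfolded continuous_on_iff, rule_format, OF this \<kappa>(1)]
    show thesis using that by (auto simp: dist_norm)
  qed
  define D where "D = 1 + a\<^sup>2"
  have D: "0 < D" by (simp add: D_def add_pos_nonneg)
  \<comment> \<open>The largest radius: points this close to \<open>a\<close> are finite, the field
    varies little there, and 0 lies at least that far away, so that the circles meet every nearby
    continuum.\<close>
  define h where "h = Min {1 / sqrt D, d / (2 * D), chord (Some 0) (Some (of_real a))}"
  have ch0: "0 < chord (Some 0) (Some (complex_of_real a))"
    using chord_eq_0_iff[of "Some 0" "Some (complex_of_real a)"] a(2) chord_ge_0[of "Some 0" "Some (complex_of_real a)"] by (simp add: less_le)
  have h: "0 < h" "h \<le> 1 / sqrt D" "h \<le> d / (2 * D)" "h \<le> chord (Some 0) (Some (of_real a))"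
    using d D ch0 by (auto simp: h_def)
  have Dh: "D * h < d" using h(3) D d by (simp add: field_simps)
  \<comment> \<open>Solved from the requirement that the kernel factor times 5 equals
    \<open>\<kappa>\<close>.\<close>
  define \<Theta> where "\<Theta> = 8 * D * (10 / \<kappa>)\<^sup>2"
  have \<Theta>: "0 < \<Theta>" using D \<kappa> by (simp add: \<Theta>_def)
  have \<Theta>2: "2 * sqrt (8 * D / \<Theta>) * 5 = \<kappa>"
  proof -
    have "8 * D / \<Theta> = (\<kappa> / 10)\<^sup>2" using D \<kappa> by (simp add: \<Theta>_def power_divide)
    thus ?thesis using \<kappa> by simp
  qed
  \<comment> \<open>The smallest radius used, reached at parameter 1; a continuum within this
    Hausdorff distance has points inside every circle used or on it.\<close>
  define \<delta> where "\<delta> = h * exp (- \<Theta>)"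
  have \<delta>: "0 < \<delta>" using h by (simp add: \<delta>_def)
  \<comment> \<open>A measure of mass \<open>m\<close> on the line; its image under a constant map
    is the point mass at \<open>pa\<close>.\<close>
  define W where "W = density lborel (\<lambda>u::real. ennreal m * indicator {0..1} u)"
  define \<mu> where "\<mu> = distr W (Kborel A) (\<lambda>_. pa)"
  have W1: "emeasure W UNIV = ennreal m"
    unfolding W_def by (subst emeasure_density) (auto simp: nn_integral_cmult_indicator)
  have spW: "space W = UNIV" by (simp add: W_def)
  have cm: "(\<lambda>_. pa) \<in> measurable W (Kborel A)" using paK by simp
  have sets_\<mu>: "sets \<mu> = sets (Kborel A)" by (simp add: \<mu>_def)
  have e\<mu>: "emeasure \<mu> (space \<mu>) = ennreal m"
    unfolding \<mu>_def using paK cm sets.top[of "Kborel A"] by (subst emeasure_distr) (auto simp: spW W1)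
  have fin: "finite_measure \<mu>" by (rule finite_measureI) (simp add: e\<mu>)
  have m\<mu>: "measure \<mu> (space \<mu>) = m" using m by (simp add: measure_def e\<mu>)
  have finW: "finite_measure W" by (rule finite_measureI) (simp add: spW W1)
  have mW: "measure W UNIV = m" using m by (simp add: measure_def W1)
  have AEpa: "AE q in \<mu>. q = pa"
  proof -
    have sing: "{q \<in> space (Kborel A). q = pa} \<in> sets (Kborel A)"
    proof -
      have "{q \<in> space (Kborel A). q = pa} = kemb A -` {kemb A pa} \<inter> space (Kborel A)"
        using inj_onD[OF kemb_inj_on[of A], of _ pa] paK by auto
      also have "\<dots> \<in> sets (Kborel A)" by measurable
      finally show ?thesis .
    qed
    show ?thesis unfolding \<mu>_def by (subst AE_distr_iff[OF cm]) (use sing in auto)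
  qed
  have en0: "energy \<mu> = 0"
    by (rule energy_point_mass[OF _ AEpa]) (simp add: Gk_zof[OF zpa zpa] Gc_def)
  have int: "integrable \<mu> (phik A \<rho>0 x t)"
    unfolding \<mu>_def using finite_measure.integrable_const[OF finW]
    by (subst integrable_distr_eq[OF cm]) (auto simp: meas)
  have "(LINT p|\<mu>. phik A \<rho>0 x t p) = m * ?phi (of_real a)"
    unfolding \<mu>_def by (subst integral_distr[OF cm]) (auto simp: meas spW mW zof_eq_Some(3)[OF zpa])
  hence Ephi\<mu>: "Ephi A \<rho>0 x t \<mu> = - (\<bar>c\<bar> + 2)" using mphi by (simp add: Ephi_def en0)
  show ?thesis
  proof (intro exI[of _ \<delta>] conjI \<delta> ballI impI)
    fix F assume F: "F \<in> FF A" and near: "hausd A F F0 < \<delta>"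
    have "F \<noteq> {}" using F by (auto simp: FF_def)
    then obtain q where q: "q \<in> F" "d0 A q pa < \<delta>"
      by (rule hausd_less_imp_near[OF _ near a(1)[folded pa_def]])
    have cq: "chord (zof q) (Some (of_real a)) \<le> \<delta>" using q(2) by (simp add: d0_def zpa)
    obtain \<sigma> where \<sigma>: "\<sigma> \<in> measurable borel (Kborel A)" "\<And>\<rho>. \<sigma> \<rho> \<in> F"
        "\<And>\<rho>. \<rho> \<in> {\<delta>..h} \<Longrightarrow> chord (zof (\<sigma> \<rho>)) (Some (of_real a)) = \<rho>"
      using FF_radial_section[OF F q(1) cq h(4)] by blast
    define \<rho> where "\<rho> u = h * exp (- \<Theta> * u)" for u
    have \<rho>: "\<rho> u \<in> {\<delta>..h}" if "u \<in> {0..1}" for u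
    proof -
      have "- \<Theta> \<le> - \<Theta> * u" "- \<Theta> * u \<le> 0" using that \<Theta> by (auto simp: mult_left_le)
      hence "exp (- \<Theta>) \<le> exp (- \<Theta> * u)" "exp (- \<Theta> * u) \<le> 1" unfolding exp_le_cancel_iff exp_le_one_iff .
      from this[THEN mult_left_mono[OF _ less_imp_le[OF h(1)]]] show ?thesis
        unfolding \<rho>_def \<delta>_def by simp
    qed
    \<comment> \<open>Only the uniform parameter matters, as \<open>\<mu>\<close> sits at a single
      point; it becomes the logarithm of the radius up to an affine change.\<close>
    define T where "T y = \<sigma> (\<rho> (snd y))" for y :: "kpt \<times> real"
    have T: "T \<in> measurable (\<mu> \<Otimes>\<^sub>M unif01) (Kborel A)"
      unfolding T_def \<rho>_def by (rule measurable_compose[OF _ \<sigma>(1)]) measurable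
    have Tz: "\<exists>w. zof (T (p, u)) = Some w \<and> 0 \<le> Im w \<and> cmod (w - of_real a) \<le> D * \<rho> u \<and> chord (Some w) (Some (of_real a)) = \<rho> u"
      if u: "u \<in> {0..1}" for p u
    proof -
      have c: "chord (zof (T (p, u))) (Some (of_real a)) = \<rho> u" using \<sigma>(3)[OF \<rho>[OF u]] by (simp add: T_def)
      have "\<rho> u \<le> 1 / sqrt (1 + a\<^sup>2)" using \<rho>[OF u] h(2) by (simp add: D_def)
      hence sm: "chord (zof (T (p, u))) (Some (complex_of_real a)) \<le> 1 / sqrt (1 + \<bar>a\<bar>\<^sup>2)" using c by simp
      have le: "cmod (complex_of_real a) \<le> \<bar>a\<bar>" by simp
      obtain w where w: "zof (T (p, u)) = Some w"
        "cmod (w - of_real a) \<le> (1 + \<bar>a\<bar>\<^sup>2) * chord (zof (T (p, u))) (Some (of_real a))"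
        by (rule chord_small_imp[OF le sm])
      have "T (p, u) \<in> Kbar A" unfolding T_def by (rule subsetD[OF FF_subset[OF F] \<sigma>(2)])
      from Kbar_Im_nonneg[OF this w(1)] show ?thesis using w c by (intro exI[of _ w]) (simp add: D_def)
    qed
    obtain \<nu> where \<nu>: "\<nu> \<in> MF A \<rho>0 x t F"
      "Ephi A \<rho>0 x t \<nu> \<le> Ephi A \<rho>0 x t \<mu>
       + \<kappa> * (enn2real (energy \<mu>) + (measure \<mu> (space \<mu>))\<^sup>2 + 2 * measure \<mu> (space \<mu>))"
    \<comment> \<open>On \<open>{pa}\<close> the kernel vanishes, so the averaged kernel on
      \<open>F\<close> must be at most \<open>\<kappa>\<close> outright.\<close>
    proof (rule transport_to_continuum[OF F fin sets_\<mu> _ int T _ AEpa[THEN eventually_mono, of "\<lambda>q. q \<in> {pa}"], of \<kappa>])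
      show "energy \<mu> < \<infinity>" by (simp add: en0)
      show "T y \<in> F" for y by (simp add: T_def \<sigma>)
    next
      fix p q u assume p: "p \<in> {pa}" and q: "q \<in> {pa}" and u: "u \<in> {0..1::real}"
      obtain z where z: "zof (T (p, u)) = Some z" "0 \<le> Im z" "cmod (z - of_real a) \<le> D * \<rho> u" "chord (Some z) (Some (of_real a)) = \<rho> u"
        using Tz[OF u] by blast
      have "(\<integral>\<^sup>+v. Gk (T (p, u)) (T (q, v)) * indicator {0..1} v \<partial>lborel)
        \<le> (\<integral>\<^sup>+v. ennreal (2 * sqrt (8 * D / \<Theta>)) * (ennreal (1 / sqrt \<bar>v - u\<bar>) * indicator {0..1} v) \<partial>lborel)"
      proof (rule nn_integral_mono_AE)
        show "AE v in lborel. Gk (T (p, u)) (T (q, v)) * indicator {0..1} v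
          \<le> ennreal (2 * sqrt (8 * D / \<Theta>)) * (ennreal (1 / sqrt \<bar>v - u\<bar>) * indicator {0..1} v)"
          using AE_lborel_singleton[of u]
        proof eventually_elim
          case (elim v)
          show ?case
          proof (cases "v \<in> {0..1}")
            case v: True
            obtain w where w: "zof (T (q, v)) = Some w" "0 \<le> Im w" "cmod (w - of_real a) \<le> D * \<rho> v" "chord (Some w) (Some (of_real a)) = \<rho> v"
              using Tz[OF v] by blast
            have "\<bar>\<rho> u - \<rho> v\<bar> / 2 \<le> cmod (z - w)"
              using chord_radius_diff_le[of z "Some (of_real a)" w] z(4) w(4) by simp
            hence "Gc z w \<le> ennreal (2 * sqrt (8 * D / \<Theta>)) * ennreal (1 / sqrt \<bar>u - v\<bar>)"
              using green_kernel_boundary[OF D h(1) \<Theta> _ z(2) w(2), of u v a] z(3) w(3) elim by (simp add: \<rho>_def)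
            thus ?thesis using v by (simp add: Gk_zof[OF z(1) w(1)] abs_minus_commute)
          qed simp
        qed
      qed
      also have "\<dots> = ennreal (2 * sqrt (8 * D / \<Theta>)) * (\<integral>\<^sup>+v. ennreal (1 / sqrt \<bar>v - u\<bar>) * indicator {0..1} v \<partial>lborel)"
        by (rule nn_integral_cmult) measurable
      also have "\<dots> \<le> ennreal (2 * sqrt (8 * D / \<Theta>)) * 5"
        by (intro mult_left_mono nn_integral_inverse_sqrt_le) auto
      also have "\<dots> = ennreal \<kappa>"
        unfolding \<Theta>2[symmetric] using D \<Theta> by (subst ennreal_mult) auto
      also have "\<dots> \<le> ennreal (1 + \<kappa>) * Gk p q + ennreal \<kappa>" by simp
      finally show "(\<integral>\<^sup>+v. Gk (T (p, u)) (T (q, v)) * indicator {0..1} v \<partial>lborel) \<le> ennreal (1 + \<kappa>) * Gk p q + ennreal \<kappa>" .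
    next
      fix p u assume p: "p \<in> {pa}" and u: "u \<in> {0..1::real}"
      obtain z where z: "zof (T (p, u)) = Some z" "0 \<le> Im z" "cmod (z - of_real a) \<le> D * \<rho> u"
        using Tz[OF u] by blast
      have "D * \<rho> u \<le> D * h" using \<rho>[OF u] D by (intro mult_left_mono) auto
      hence "cmod (z - of_real a) < d" using z(3) Dh by linarith
      from d(2)[OF z(2) this]
      show "\<bar>phik A \<rho>0 x t (T (p, u)) - phik A \<rho>0 x t p\<bar> \<le> \<kappa>"
        unfolding zof_eq_Some(3)[OF z(1)] using p by (simp add: zof_eq_Some(3)[OF zpa])
    qed (use \<kappa> in auto)
    have "Ephi A \<rho>0 x t \<nu> \<le> - (\<bar>c\<bar> + 2) + \<kappa> * (m\<^sup>2 + 2 * m)"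
      using \<nu>(2) by (simp add: Ephi\<mu> en0 m\<mu>)
    hence "Ephi A \<rho>0 x t \<nu> < c" using \<kappa>(2) by linarith
    thus "\<exists>\<nu>\<in>MF A \<rho>0 x t F. Ephi A \<rho>0 x t \<nu> < c" using \<nu>(1) by blast
  qed
qed

text \<open>Each piece of \<open>\<mu>\<close> of size about \<open>r\<close> is replaced by a measure on \<open>F\<close> that is uniformly
  distributed over the chordal distances between \<open>r\<close> and \<open>2 r\<close> from a nearby centre.\<close>
lemma interior_case:
  fixes A x t h R \<kappa> :: real
  assumes F0: "F0 \<in> FF A" and h: "0 < h" and \<kappa>: "0 < \<kappa>"
    and cont: "continuous_on {z. 0 \<le> Im z} (phi A \<rho>0 x t)"
    and fin: "finite_measure \<mu>" and sets_\<mu>: "sets \<mu> = sets (Kborel A)"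
    and en: "energy \<mu> < \<infinity>" and int: "integrable \<mu> (phik A \<rho>0 x t)"
    and supp: "AE p in \<mu>. p \<in> F0 \<and> p \<noteq> KInf \<and> h \<le> Im (kz p) \<and> cmod (kz p) \<le> R"
  shows "\<exists>\<delta>>0. \<forall>F\<in>FF A. hausd A F F0 < \<delta> \<longrightarrow> (\<exists>\<nu>\<in>MF A \<rho>0 x t F.
      Ephi A \<rho>0 x t \<nu> \<le> Ephi A \<rho>0 x t \<mu>
       + \<kappa> * (enn2real (energy \<mu>) + (measure \<mu> (space \<mu>))\<^sup>2 + 2 * measure \<mu> (space \<mu>)))"
proof -
  let ?phi = "phi A \<rho>0 x t"
  define S where "S = {p \<in> F0. p \<noteq> KInf \<and> h \<le> Im (kz p) \<and> cmod (kz p) \<le> R}"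
  have AES: "AE p in \<mu>. p \<in> S" using supp by (simp add: S_def)
  have zS: "zof p = Some (kz p)" if "p \<in> S" for p
    using that by (cases p) (auto simp: S_def kz_def)
  \<comment> \<open>A compact enlargement of the support that still contains the moved
    points.\<close>
  define C where "C = {z. h / 2 \<le> Im z} \<inter> cball 0 (R + 1)"
  have "compact C" unfolding C_def
    by (intro closed_Int_compact closed_halfspace_Im_ge) simp
  moreover have "continuous_on C ?phi" using h by (intro continuous_on_subset[OF cont]) (auto simp: C_def)
  ultimately have "uniformly_continuous_on C ?phi" by (intro compact_uniformly_continuous)
  then obtain d where d: "d > 0" "\<forall>z\<in>C. \<forall>w\<in>C. dist w z < d \<longrightarrow> dist (?phi w) (?phi z) < \<kappa>"
    using \<kappa> unfolding uniformly_continuous_on_def by blast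
  define L where "L = sqrt (1 + R\<^sup>2)"
  have L: "0 < L" by (simp add: L_def add_pos_nonneg)
  \<comment> \<open>Moved points stay within chordal distance \<open>3 * r\<close>; the factor
    \<open>1 + R\<^sup>2\<close> converts this to Euclidean distance.\<close>
  define D where "D = 3 * (1 + R\<^sup>2)"
  have D: "0 < D" by (simp add: D_def add_pos_nonneg)
  obtain r0 where r0: "r0 > 0"
    "\<forall>r p q z Z s. 0 < r \<and> r < r0 \<and> h \<le> Im p \<and> h \<le> Im q \<and> cmod (z - p) \<le> D * r \<and>
       (\<forall>v\<in>{0..1}. cmod (Z v - q) \<le> D * r \<and> r / 2 * \<bar>v - s\<bar> \<le> cmod (z - Z v))
     \<longrightarrow> (\<integral>\<^sup>+v. Gc z (Z v) * indicator {0..1} v \<partial>lborel) \<le> ennreal (1 + \<kappa>) * Gc p q + ennreal \<kappa>"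
    using green_kernel_perturb[OF \<kappa> h D] by blast
  \<comment> \<open>In order: the kernel estimate applies, moved points are finite, the field
    changes by less than \<open>\<kappa>\<close>, two conditions keep moved points in
    \<open>C\<close>, and 0 lies outside the circles of radius up to \<open>2 * r\<close>.\<close>
  define r where "r = Min {r0 / 2, 1 / (3 * L), d / (2 * D), h / (2 * D), 1 / D, h / L}"
  have r: "0 < r" using r0 L D d h by (simp add: r_def)
  have "r \<le> r0 / 2" "r \<le> 1 / (3 * L)" "r \<le> d / (2 * D)" "r \<le> h / (2 * D)" "r \<le> 1 / D" "r \<le> h / L"
    unfolding r_def by (rule Min_le, simp, simp)+
  hence rr: "r < r0" "3 * r \<le> 1 / L" "D * r < d" "D * r \<le> h / 2" "D * r \<le> 1" "2 * r \<le> 2 * h / L"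
    using r0 L D d h by (auto simp: field_simps)
  define C0 where "C0 = {z. h \<le> Im z} \<inter> cball 0 R"
  have "compact C0" unfolding C0_def by (intro closed_Int_compact closed_halfspace_Im_ge) simp
  moreover have "C0 \<subseteq> (\<Union>b\<in>C0. ball b (r / 4))" using r by auto
  ultimately obtain B where B: "B \<subseteq> C0" "finite B" "C0 \<subseteq> (\<Union>b\<in>B. ball b (r / 4))"
    using compactE_image[of C0 C0 "\<lambda>b. ball b (r / 4)"] by auto
  obtain bs where bs: "set bs = B" using finite_list[OF B(2)] by blast
  \<comment> \<open>The first ball of the finite cover containing the point; the least index gives
    disjoint Borel cells.\<close>
  define idx where "idx p = (LEAST i. i < length bs \<and> kz p \<in> ball (bs ! i) (r / 4))" for p
  have idx: "idx p < length bs" "cmod (kz p - bs ! idx p) < r / 4" if p: "p \<in> S" for p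
  proof -
    have "kz p \<in> C0" using p by (auto simp: S_def C0_def)
    then obtain b where "b \<in> B" "kz p \<in> ball b (r / 4)" using B(3) by auto
    then obtain i where "i < length bs \<and> kz p \<in> ball (bs ! i) (r / 4)" by (metis bs in_set_conv_nth)
    from LeastI[where P="\<lambda>i. i < length bs \<and> kz p \<in> ball (bs ! i) (r / 4)", OF this]
    show "idx p < length bs" "cmod (kz p - bs ! idx p) < r / 4"
      unfolding idx_def by (auto simp: dist_norm norm_minus_commute)
  qed
  have idx_meas: "idx \<in> measurable (Kborel A) (count_space UNIV)"
    unfolding idx_def[abs_def]
    by (rule measurable_Least) (intro pred_intros_logic, auto)
  show ?thesis
  proof (intro exI[of _ "r / 2"] conjI ballI impI)
    show "0 < r / 2" using r by simp
    fix F assume F: "F \<in> FF A" and near: "hausd A F F0 < r / 2"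
    have Fne: "F \<noteq> {}" using F by (auto simp: FF_def)
    \<comment> \<open>\<open>F\<close> need not come near a centre whose cell misses
      \<open>S\<close>. Such indices, and those outside the list, get a constant map into
      \<open>F\<close>.\<close>
    have sec: "\<exists>\<sigma>. \<sigma> \<in> measurable borel (Kborel A) \<and> (\<forall>\<rho>. \<sigma> \<rho> \<in> F) \<and>
        ((\<exists>p\<in>S. idx p = i) \<longrightarrow> (\<forall>\<rho>\<in>{r..2 * r}. chord (zof (\<sigma> \<rho>)) (Some (bs ! i)) = \<rho>))" for i
    proof (cases "\<exists>p\<in>S. idx p = i")
      case True
      then obtain p where p: "p \<in> S" "idx p = i" by blast
      have pF: "p \<in> F0" using p by (simp add: S_def)
      obtain q where q: "q \<in> F" "d0 A q p < r / 2" by (rule hausd_less_imp_near[OF Fne near pF])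
      have "chord (zof q) (zof p) < r / 2" using q(2) by (simp add: d0_def)
      moreover have "chord (zof p) (Some (bs ! i)) \<le> 2 * cmod (kz p - bs ! i)"
        unfolding zS[OF p(1)] by (rule chord_Some_le)
      \<comment> \<open>\<open>r / 2\<close> from the Hausdorff distance, and twice
        \<open>r / 4\<close> from the cell.\<close>
      ultimately have cq: "chord (zof q) (Some (bs ! i)) \<le> r"
        using idx(2)[OF p(1), unfolded p(2)] chord_triangle[of "zof q" "Some (bs ! i)" "zof p"] by linarith
      have bC: "bs ! i \<in> C0" using idx(1)[OF p(1), unfolded p(2)] bs B(1) nth_mem[of i bs] by blast
      have c0: "2 * r \<le> chord (Some 0) (Some (bs ! i))"
      proof -
        define b where "b = bs ! i"
        have b: "h \<le> Im b" "cmod b \<le> R" using bC by (auto simp: b_def C0_def)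
        have hb: "h \<le> cmod b" using b abs_Im_le_cmod[of b] by linarith
        have "sqrt (1 + (cmod b)\<^sup>2) \<le> L" using b by (auto simp: L_def intro!: power_mono)
        hence "2 * h / L \<le> 2 * cmod b / sqrt (1 + (cmod b)\<^sup>2)"
          using hb h L one_plus_norm_sq_pos[of b] by (intro frac_le) auto
        thus ?thesis using rr(6) by (simp add: chord_def b_def)
      qed
      show ?thesis using FF_radial_section[OF F q(1) cq c0] by blast
    next
      case False
      obtain p where p: "p \<in> F" using Fne by blast
      hence "(\<lambda>_. p) \<in> measurable borel (Kborel A)" using FF_subset[OF F] by auto
      thus ?thesis using False p by blast
    qed
    have "\<forall>i. \<exists>\<sigma>. \<sigma> \<in> measurable borel (Kborel A) \<and> (\<forall>\<rho>. \<sigma> \<rho> \<in> F) \<and>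
        ((\<exists>p\<in>S. idx p = i) \<longrightarrow> (\<forall>\<rho>\<in>{r..2 * r}. chord (zof (\<sigma> \<rho>)) (Some (bs ! i)) = \<rho>))"
      using sec by (rule allI)
    from choice[OF this] obtain \<sigma> where "\<forall>i. \<sigma> i \<in> measurable borel (Kborel A) \<and> (\<forall>\<rho>. \<sigma> i \<rho> \<in> F) \<and>
        ((\<exists>p\<in>S. idx p = i) \<longrightarrow> (\<forall>\<rho>\<in>{r..2 * r}. chord (zof (\<sigma> i \<rho>)) (Some (bs ! i)) = \<rho>))"
      by blast
    hence \<sigma>: "\<And>i. \<sigma> i \<in> measurable borel (Kborel A)" "\<And>i \<rho>. \<sigma> i \<rho> \<in> F"
      "\<And>i \<rho>. \<exists>p\<in>S. idx p = i \<Longrightarrow> \<rho> \<in> {r..2 * r} \<Longrightarrow> chord (zof (\<sigma> i \<rho>)) (Some (bs ! i)) = \<rho>"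
      by blast+
    define T where "T y = \<sigma> (idx (fst y)) (r * (1 + snd y))" for y :: "kpt \<times> real"
    have T: "T \<in> measurable (\<mu> \<Otimes>\<^sub>M unif01) (Kborel A)"
      unfolding T_def
    proof (rule measurable_compose_countable'[where I=UNIV and g="\<lambda>y. idx (fst y)"
          and f="\<lambda>i y. \<sigma> i (r * (1 + snd y))"])
      show "(\<lambda>y. \<sigma> i (r * (1 + snd y))) \<in> measurable (\<mu> \<Otimes>\<^sub>M unif01) (Kborel A)" for i
        by (rule measurable_compose[OF _ \<sigma>(1)]) measurable
      show "(\<lambda>y. idx (fst y)) \<in> measurable (\<mu> \<Otimes>\<^sub>M unif01) (count_space UNIV)"
        using idx_meas unfolding measurable_cong_sets[OF sets_\<mu>[symmetric] refl]
        by (rule measurable_compose[OF measurable_fst])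
    qed auto
    have TF: "T y \<in> F" for y by (simp add: T_def \<sigma>)
    have Tz: "\<exists>w. zof (T (p, u)) = Some w \<and> 0 \<le> Im w \<and> cmod (w - kz p) \<le> D * r
        \<and> chord (Some w) (Some (bs ! idx p)) = r * (1 + u)"
      if p: "p \<in> S" and u: "u \<in> {0..1}" for p u
    proof -
      have ru: "r * (1 + u) \<in> {r..2 * r}" using u r by (auto simp: algebra_simps mult_left_le)
      have ex: "\<exists>p'\<in>S. idx p' = idx p" using p by blast
      have c: "chord (zof (T (p, u))) (Some (bs ! idx p)) = r * (1 + u)"
        using \<sigma>(3)[OF ex ru] by (simp add: T_def)
      have "chord (Some (bs ! idx p)) (Some (kz p)) \<le> 2 * cmod (bs ! idx p - kz p)" by (rule chord_Some_le)
      hence c3: "chord (zof (T (p, u))) (Some (kz p)) \<le> 3 * r"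
        using c ru idx(2)[OF p] r chord_triangle[of "zof (T (p, u))" "Some (kz p)" "Some (bs ! idx p)"]
          norm_minus_commute[of "bs ! idx p" "kz p"] unfolding atLeastAtMost_iff by linarith
      hence sm: "chord (zof (T (p, u))) (Some (kz p)) \<le> 1 / sqrt (1 + R\<^sup>2)"
        using rr(2) by (simp add: L_def)
      have zR: "cmod (kz p) \<le> R" using p by (simp add: S_def)
      obtain w where w: "zof (T (p, u)) = Some w"
        "cmod (w - kz p) \<le> (1 + R\<^sup>2) * chord (zof (T (p, u))) (Some (kz p))"
        by (rule chord_small_imp[OF zR sm])
      have "(1 + R\<^sup>2) * chord (zof (T (p, u))) (Some (kz p)) \<le> (1 + R\<^sup>2) * (3 * r)"
        by (rule mult_left_mono[OF c3]) simp
      hence "cmod (w - kz p) \<le> D * r" using w(2) by (simp add: D_def algebra_simps)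
      moreover have "T (p, u) \<in> Kbar A" by (rule subsetD[OF FF_subset[OF F] TF])
      ultimately show ?thesis using Kbar_Im_nonneg[OF _ w(1)] w(1) c by (intro exI[of _ w]) simp
    qed
    obtain \<nu> where "\<nu> \<in> MF A \<rho>0 x t F"
      "Ephi A \<rho>0 x t \<nu> \<le> Ephi A \<rho>0 x t \<mu>
       + \<kappa> * (enn2real (energy \<mu>) + (measure \<mu> (space \<mu>))\<^sup>2 + 2 * measure \<mu> (space \<mu>))"
    proof (rule transport_to_continuum[OF F fin sets_\<mu> en int T TF AES less_imp_le[OF \<kappa>]])
      fix p q u assume p: "p \<in> S" and q: "q \<in> S" and u: "u \<in> {0..1::real}"
      obtain z where z: "zof (T (p, u)) = Some z" "cmod (z - kz p) \<le> D * r"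
        using Tz[OF p u] by blast
      define b where "b = Some (bs ! idx q)"
      \<comment> \<open>The parameter at which the circle about the centre for \<open>q\<close>
        would pass through \<open>z\<close>; it may lie outside the unit interval.\<close>
      define s where "s = chord (Some z) b / r - 1"
      have Zv: "zof (T (q, v)) = Some (kz (T (q, v))) \<and> cmod (kz (T (q, v)) - kz q) \<le> D * r
          \<and> r / 2 * \<bar>v - s\<bar> \<le> cmod (z - kz (T (q, v)))" if v: "v \<in> {0..1}" for v
      proof -
        obtain w where w: "zof (T (q, v)) = Some w" "cmod (w - kz q) \<le> D * r"
            "chord (Some w) b = r * (1 + v)"
          using Tz[OF q v] unfolding b_def by blast
        have "chord (Some z) b - chord (Some w) b = r * (s - v)"
          using r by (simp add: s_def w(3) algebra_simps)
        hence "\<bar>chord (Some z) b - chord (Some w) b\<bar> = r * \<bar>v - s\<bar>"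
          using r by (simp add: abs_mult abs_minus_commute)
        hence "r / 2 * \<bar>v - s\<bar> \<le> cmod (z - w)" using chord_radius_diff_le[of z b w] by simp
        thus ?thesis using w zof_eq_Some(2)[OF w(1)] by simp
      qed
      have "(\<integral>\<^sup>+v. Gk (T (p, u)) (T (q, v)) * indicator {0..1} v \<partial>lborel)
          = (\<integral>\<^sup>+v. Gc z (kz (T (q, v))) * indicator {0..1} v \<partial>lborel)"
      proof (rule nn_integral_cong)
        fix v :: real
        show "Gk (T (p, u)) (T (q, v)) * indicator {0..1} v = Gc z (kz (T (q, v))) * indicator {0..1} v"
        proof (cases "v \<in> {0..1}")
          case True
          show ?thesis using Gk_zof[OF z(1) Zv[OF True, THEN conjunct1]] by simp
        qed simp
      qed
      also have "\<dots> \<le> ennreal (1 + \<kappa>) * Gc (kz p) (kz q) + ennreal \<kappa>"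
        by (rule r0(2)[rule_format, of r "kz p" "kz q" z "\<lambda>v. kz (T (q, v))" s])
           (use r rr(1) z(2) p q Zv in \<open>simp add: S_def\<close>)
      finally show "(\<integral>\<^sup>+v. Gk (T (p, u)) (T (q, v)) * indicator {0..1} v \<partial>lborel) \<le> ennreal (1 + \<kappa>) * Gk p q + ennreal \<kappa>"
        using Gk_zof[OF zS[OF p] zS[OF q]] by simp
    next
      fix p u assume p: "p \<in> S" and u: "u \<in> {0..1::real}"
      obtain z where z: "zof (T (p, u)) = Some z" "cmod (z - kz p) \<le> D * r" using Tz[OF p u] by blast
      have pC: "kz p \<in> C" using p h by (auto simp: S_def C_def)
      have "\<bar>Im (z - kz p)\<bar> \<le> h / 2" using abs_Im_le_cmod[of "z - kz p"] z(2) rr(4) by linarith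
      moreover have "h \<le> Im (kz p)" using p by (simp add: S_def)
      ultimately have "h / 2 \<le> Im z" unfolding minus_complex.sel abs_le_iff by linarith
      moreover have "cmod z \<le> R + 1"
        using norm_triangle_sub[of z "kz p"] z(2) rr(5) p by (simp add: S_def)
      ultimately have zC: "z \<in> C" by (simp add: C_def)
      have "cmod (z - kz p) < d" using z(2) rr(3) by linarith
      hence "\<bar>?phi z - ?phi (kz p)\<bar> < \<kappa>" using d(2)[rule_format, OF pC zC] by (simp add: dist_norm)
      thus "\<bar>phik A \<rho>0 x t (T (p, u)) - phik A \<rho>0 x t p\<bar> \<le> \<kappa>"
        unfolding zof_eq_Some(3)[OF z(1)] zof_eq_Some(3)[OF zS[OF p]] by simp
    qed blast
    thus "\<exists>\<nu>\<in>MF A \<rho>0 x t F. Ephi A \<rho>0 x t \<nu> \<le> Ephi A \<rho>0 x t \<mu>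
       + \<kappa> * (enn2real (energy \<mu>) + (measure \<mu> (space \<mu>))\<^sup>2 + 2 * measure \<mu> (space \<mu>))" by blast
  qed
qed

section \<open>Upper semicontinuity\<close>

text \<open>By \<open>cmod_diff_cnj_sq\<close> the squared ratio in the logarithm is
  \<open>1 + 4 * Im z * Im w / \<bar>z - w\<bar>\<^sup>2\<close>, and the distance is at most
  \<open>2 * R\<close>.\<close>

lemma Gc_ge:
  assumes h: "0 < h" and z: "h \<le> Im z" "cmod z \<le> R" and w: "h \<le> Im w" "cmod w \<le> R"
  shows "ennreal (ln (1 + (h / R)\<^sup>2) / 2) \<le> Gc z w"
proof (cases "z = w")
  case True
  thus ?thesis using z h by (simp add: Gc_def)
next
  case False
  have R: "0 < R" using abs_Im_le_cmod[of z] z h by linarith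
  have zw: "0 < cmod (z - w)" using False by simp
  have "cmod (z - w) \<le> 2 * R" using norm_triangle_ineq4[of z w] z w by linarith
  hence zw2: "(cmod (z - w))\<^sup>2 \<le> (2 * R)\<^sup>2" by (intro power_mono) auto
  have hh: "h * h \<le> Im z * Im w" using z w h by (intro mult_mono) auto
  have "(h / R)\<^sup>2 = (4 * (h * h)) / (2 * R)\<^sup>2" by (simp add: power2_eq_square)
  also have "\<dots> \<le> (4 * Im z * Im w) / (cmod (z - w))\<^sup>2"
  proof (rule frac_le)
    show "0 \<le> 4 * Im z * Im w" using z w h by simp
  qed (use hh zw2 zw in auto)
  finally have "1 + (h / R)\<^sup>2 \<le> 1 + (4 * Im z * Im w) / (cmod (z - w))\<^sup>2" by simp
  also have "\<dots> = (cmod (z - cnj w) / cmod (z - w))\<^sup>2"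
    using zw by (simp add: power_divide cmod_diff_cnj_sq add_divide_distrib)
  finally have "ln (1 + (h / R)\<^sup>2) \<le> ln ((cmod (z - cnj w) / cmod (z - w))\<^sup>2)"
    by (intro ln_mono) (auto simp: add_pos_nonneg)
  also have "\<dots> = 2 * ln (cmod (z - cnj w) / cmod (z - w))" by (simp add: ln_realpow)
  finally have "ln (1 + (h / R)\<^sup>2) / 2 \<le> ln (cmod (z - cnj w) / cmod (z - w))" by simp
  thus ?thesis using False by (simp add: Gc_def ennreal_leI)
qed

text \<open>Members of \<open>MM\<close> may have infinite mass. Where the kernel is bounded below
  by a positive constant, infinite mass would force infinite energy.\<close>

lemma finite_of_energy_finite:
  assumes en: "energy \<mu> < \<infinity>" and h: "0 < h"
    and supp: "AE p in \<mu>. p \<noteq> KInf \<and> h \<le> Im (kz p) \<and> cmod (kz p) \<le> R"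
  shows "finite_measure \<mu>"
proof (rule finite_measureI, rule notI)
  assume top: "emeasure \<mu> (space \<mu>) = \<infinity>"
  have "AE p in \<mu>. 0 < R"
    using supp
  proof eventually_elim
    case (elim p)
    thus ?case using abs_Im_le_cmod[of "kz p"] h by linarith
  qed
  \<comment> \<open>If \<open>R\<close> were not positive, the whole space would be null, against
    its infinite mass.\<close>
  hence R: "0 < R" using top by (cases "0 < R") (auto simp: AE_iff_null null_sets_def)
  define g where "g = ennreal (ln (1 + (h / R)\<^sup>2) / 2)"
  have "0 < ln (1 + (h / R)\<^sup>2)" using h R by (intro ln_gt_zero) simp
  hence g: "0 < g" by (simp add: g_def)
  have "\<infinity> = (\<integral>\<^sup>+p. (\<integral>\<^sup>+q. g \<partial>\<mu>) \<partial>\<mu>)" using g top by (simp add: ennreal_mult_top ennreal_top_mult)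
  also have "\<dots> \<le> energy \<mu>"
    unfolding energy_def
  proof (rule nn_integral_mono_AE)
    show "AE p in \<mu>. (\<integral>\<^sup>+q. g \<partial>\<mu>) \<le> (\<integral>\<^sup>+q. Gk p q \<partial>\<mu>)"
      using supp
    proof eventually_elim
      case (elim p)
      show ?case
      proof (rule nn_integral_mono_AE)
        show "AE q in \<mu>. g \<le> Gk p q" using supp
        proof eventually_elim
          case (elim q)
          thus ?case using \<open>p \<noteq> KInf \<and> _\<close> Gc_ge[OF h, of "kz p" R "kz q"] by (simp add: Gk_eq g_def)
        qed
      qed
    qed
  qed
  finally show False using en by simp
qed

theorem theorem3:
  fixes A x t :: real and \<rho>0 :: "complex \<Rightarrow> complex"
  assumes "0 < A" and "0 \<le> x" and "0 \<le> t"
    and "\<rho>0 holomorphic_on {z. 0 < Im z}"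
    and "continuous_on {z. 0 \<le> Im z} \<rho>0"
    and "\<forall>s\<in>{0..A}. Re (\<rho>0 (\<i> * complex_of_real s)) = 0"
    and "\<forall>s\<in>{0<..A}. 0 < Im (\<rho>0 (\<i> * complex_of_real s))"
    and "\<forall>r::real. 0 < Im (\<rho>0 (complex_of_real r))"
  shows "\<forall>F0\<in>FF A. \<forall>c. EphiF A \<rho>0 x t F0 < c \<longrightarrow>
           (\<exists>\<delta>>0. \<forall>F\<in>FF A. hausd A F F0 < \<delta> \<longrightarrow> EphiF A \<rho>0 x t F < c)"
proof (intro ballI allI impI)
  fix F0 c assume F0: "F0 \<in> FF A" and less: "EphiF A \<rho>0 x t F0 < c"
  let ?f = "phik A \<rho>0 x t" and ?E = "Ephi A \<rho>0 x t"
  note hyps = assms(1,4,5,6,8)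
  have cont: "continuous_on {z. 0 \<le> Im z} (phi A \<rho>0 x t)" by (rule continuous_on_phi[OF hyps])
  obtain \<mu>0 where \<mu>0: "\<mu>0 \<in> MF A \<rho>0 x t F0" "ereal (?E \<mu>0) < c"
    using less unfolding EphiF_def INF_less_iff by blast
  \<comment> \<open>\<open>c\<close> is an extended real and the bound for \<open>F\<close> has to
    be strict; a real level in between serves both.\<close>
  then obtain c' where c': "?E \<mu>0 < c'" "ereal c' < c"
    using ereal_dense2[OF \<mu>0(2)] by auto
  have sets0: "sets \<mu>0 = sets (Kborel A)" and en0: "energy \<mu>0 < \<infinity>" and int0: "integrable \<mu>0 ?f"
    and supp0: "emeasure \<mu>0 (Kbar A - F0) = 0"
    using \<mu>0(1) by (auto simp: MF_def MM_def)
  have sp0: "space \<mu>0 = Kbar A" using sets_eq_imp_space_eq[OF sets0] by simp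
  have meas: "?f \<in> borel_measurable (Kborel A)"
    using borel_measurable_integrable[OF int0] unfolding measurable_cong_sets[OF sets0 refl] .
  have suff: "EphiF A \<rho>0 x t F < c" if ex: "\<exists>\<nu>\<in>MF A \<rho>0 x t F. ?E \<nu> < c'" for F
  proof -
    obtain \<nu> where \<nu>: "\<nu> \<in> MF A \<rho>0 x t F" "?E \<nu> < c'" using ex by blast
    have "EphiF A \<rho>0 x t F \<le> ereal (?E \<nu>)" unfolding EphiF_def by (rule INF_lower[OF \<nu>(1)])
    also have "\<dots> < ereal c'" using \<nu>(2) by simp
    finally show ?thesis using c'(2) by (rule less_trans)
  qed
  have "\<exists>\<delta>>0. \<forall>F\<in>FF A. hausd A F F0 < \<delta> \<longrightarrow> (\<exists>\<nu>\<in>MF A \<rho>0 x t F. ?E \<nu> < c')"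
  proof (cases "\<exists>a>0. KPt (of_real a) False \<in> F0")
    case True
    then obtain a :: real where a: "a > 0" "KPt (of_real a) False \<in> F0" by blast
    show ?thesis
      by (rule boundary_case[OF F0 a(2) _ meas cont]) (use a phi_of_real_sign[OF hyps] in auto)
  next
    case False
    define S where "S n = {p \<in> F0. p \<noteq> KInf \<and> 1 / real (Suc n) \<le> Im (kz p) \<and> cmod (kz p) \<le> real (Suc n)}" for n
    define \<mu> where "\<mu> n = density \<mu>0 (indicator (S n))" for n
    have S_sets: "S n \<in> sets \<mu>0" for n
    proof -
      have "S n = F0 \<inter> {p \<in> space (Kborel A). p \<noteq> KInf \<and> 1 / real (Suc n) \<le> Im (kz p) \<and> cmod (kz p) \<le> real (Suc n)}"
        using FF_subset[OF F0] by (auto simp: S_def)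
      also have "\<dots> \<in> sets (Kborel A)" by (intro sets.Int FF_in_sets[OF F0]) measurable
      finally show ?thesis by (simp add: sets0)
    qed
    have [measurable]: "S n \<in> sets \<mu>0" for n by (rule S_sets)
    have sets_n: "sets (\<mu> n) = sets (Kborel A)" for n by (simp add: \<mu>_def sets0)
    have le: "\<mu> n \<le> \<mu>0" for n
    proof (rule le_measure[THEN iffD2], goal_cases)
      case 1 show ?case by (simp add: \<mu>_def)
    next
      case 2
      have "emeasure (\<mu> n) X \<le> emeasure \<mu>0 X" if "X \<in> sets \<mu>0" for X
      proof -
        have "emeasure (\<mu> n) X = (\<integral>\<^sup>+p. indicator (S n) p * indicator X p \<partial>\<mu>0)"
          unfolding \<mu>_def using that by (intro emeasure_density) auto
        also have "\<dots> \<le> (\<integral>\<^sup>+p. indicator X p \<partial>\<mu>0)" by (intro nn_integral_mono) (auto simp: indicator_def)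
        finally show ?thesis using that by simp
      qed
      thus ?case by (simp add: \<mu>_def)
    qed
    have en_le: "energy (\<mu> n) \<le> energy \<mu>0" for n
    proof -
      have s: "sets (\<mu> n) = sets \<mu>0" by (simp add: \<mu>_def)
      have "energy (\<mu> n) \<le> (\<integral>\<^sup>+p. (\<integral>\<^sup>+q. Gk p q \<partial>\<mu>0) \<partial>\<mu> n)"
        unfolding energy_def by (intro nn_integral_mono nn_integral_mono_measure[OF s le])
      also have "\<dots> \<le> energy \<mu>0" unfolding energy_def by (rule nn_integral_mono_measure[OF s le])
      finally show ?thesis .
    qed
    have AES: "AE p in \<mu> n. p \<in> S n" for n
      unfolding \<mu>_def by (subst AE_density) (auto simp: indicator_def)
    have supp: "AE p in \<mu> n. p \<in> F0 \<and> p \<noteq> KInf \<and> 1 / real (Suc n) \<le> Im (kz p) \<and> cmod (kz p) \<le> real (Suc n)" for n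
      using AES[of n] by (simp add: S_def)
    have fin: "finite_measure (\<mu> n)" for n
    proof (rule finite_of_energy_finite)
      show "energy (\<mu> n) < \<infinity>" using en_le en0 by (rule le_less_trans)
      show "AE p in \<mu> n. p \<noteq> KInf \<and> 1 / real (Suc n) \<le> Im (kz p) \<and> cmod (kz p) \<le> real (Suc n)"
        using supp[of n] by eventually_elim blast
    qed simp
    have f0: "?f \<in> borel_measurable \<mu>0" by (rule borel_measurable_integrable[OF int0])
    have real_ind: "indicator (S n) = (\<lambda>p. ennreal (indicator (S n) p))" for n :: nat
      by (auto simp: fun_eq_iff indicator_def)
    have dens: "\<mu> n = density \<mu>0 (\<lambda>p. ennreal (indicator (S n) p))" for n
      unfolding \<mu>_def by (simp only: real_ind)
    have int_n: "integrable (\<mu> n) ?f" for n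
      unfolding dens using integrable_mult_indicator[OF S_sets int0, of n]
      by (subst integrable_density) (auto simp: f0)
    have lint_n: "(LINT p|\<mu> n. ?f p) = (LINT p|\<mu>0. indicator (S n) p * ?f p)" for n
      unfolding dens by (subst integral_density) (auto simp: f0)
    define SU where "SU = (\<Union>n. S n)"
    have SU_sets: "SU \<in> sets \<mu>0" unfolding SU_def by (intro sets.countable_UN) auto
    \<comment> \<open>Only the field needs a limit. The kernel is nonnegative, so the energy of each
      restriction is at most that of \<open>\<mu>0\<close>.\<close>
    have lim: "(\<lambda>n. LINT p|\<mu>0. indicator (S n) p * ?f p) \<longlonglongrightarrow> (LINT p|\<mu>0. indicator SU p * ?f p)"
    proof (rule integral_dominated_convergence[where w="\<lambda>p. \<bar>?f p\<bar>"])
      have "incseq S"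
      proof (rule incseq_SucI, rule subsetI)
        fix n p assume "p \<in> S n"
        moreover have "1 / real (Suc (Suc n)) \<le> 1 / real (Suc n)" by (simp add: field_simps)
        ultimately show "p \<in> S (Suc n)" unfolding S_def by (auto intro: order_trans)
      qed
      hence "(\<lambda>n. indicator (S n) p :: real) \<longlonglongrightarrow> indicator SU p" for p
        unfolding SU_def by (rule LIMSEQ_indicator_incseq)
      thus "AE p in \<mu>0. (\<lambda>n. indicator (S n) p * ?f p) \<longlonglongrightarrow> indicator SU p * ?f p"
        by (intro AE_I2 tendsto_mult_right)
      show "AE p in \<mu>0. norm (indicator (S n) p * ?f p) \<le> \<bar>?f p\<bar>" for n
        by (intro AE_I2) (auto simp: indicator_def)
    qed (use f0 SU_sets int0 in auto)
    have AEF0: "AE p in \<mu>0. p \<in> F0"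
    proof (rule AE_I[OF _ supp0])
      show "Kbar A - F0 \<in> sets \<mu>0" using sets.compl_sets[OF FF_in_sets[OF F0]] by (simp add: sets0)
    qed (auto simp: sp0)
    \<comment> \<open>\<open>SU\<close> is the part of \<open>F0\<close> in the open half-plane.
      What remains is infinity and real points, none of them positive in this case, and there the
      field is nonnegative. Removing this part can only lower the field integral.\<close>
    have out: "0 \<le> ?f p" if p: "p \<in> F0" "p \<notin> SU" for p
    proof (cases "zof p")
      case None thus ?thesis by (simp add: phik_def)
    next
      case (Some z)
      note zp = zof_eq_Some[OF Some]
      have pK: "p \<in> Kbar A" using p FF_subset[OF F0] by blast
      have Imz: "0 \<le> Im z" by (rule Kbar_Im_nonneg[OF pK Some])
      have "Im z = 0"
      proof (rule ccontr)
        assume "Im z \<noteq> 0"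
        hence "0 < Im z" using Imz by simp
        then obtain k where k: "1 / real (Suc k) < Im z"
          using reals_Archimedean[of "Im z"] by (auto simp: inverse_eq_divide)
        obtain l where l: "cmod z \<le> real l" using real_arch_simple by blast
        define n where "n = max k l"
        have "1 / real (Suc n) \<le> 1 / real (Suc k)" by (intro frac_le) (auto simp: n_def)
        moreover have "real l \<le> real (Suc n)" by (simp add: n_def)
        ultimately have "p \<in> S n" using k l p zp by (simp add: S_def)
        thus False using p by (auto simp: SU_def)
      qed
      hence zr: "z = of_real (Re z)" by (simp add: complex_eq_iff)
      have "Re z \<le> 0"
      proof (rule ccontr)
        assume pos: "\<not> Re z \<le> 0"
        obtain b where b: "p = KPt z b" using Some by (cases p) auto
        \<comment> \<open>Off the slit the flag is \<open>False\<close>, so the point is one of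
          those excluded by the case assumption.\<close>
        have "\<not> b" using pK pos unfolding b Kbar_def on_slit_def by auto
        hence "KPt (of_real (Re z)) False \<in> F0" using p(1) b zr by simp
        thus False using False pos by auto
      qed
      thus ?thesis using phi_of_real_sign(2)[OF hyps] zr zp(3) by metis
    qed
    have "(LINT p|\<mu>0. indicator SU p * ?f p) \<le> (LINT p|\<mu>0. ?f p)"
    proof (rule integral_mono_AE)
      show "integrable \<mu>0 (\<lambda>p. indicator SU p * ?f p)"
        using integrable_mult_indicator[OF SU_sets int0] by simp
      show "AE p in \<mu>0. indicator SU p * ?f p \<le> ?f p"
        using AEF0 by eventually_elim (use out in \<open>auto simp: indicator_def\<close>)
    qed (rule int0)
    moreover define e0 where "e0 = enn2real (energy \<mu>0)"
    ultimately have "(LINT p|\<mu>0. indicator SU p * ?f p) < (c' - e0) / 2"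
      using c'(1) unfolding Ephi_def e0_def by (simp add: field_simps)
    from order_tendstoD(2)[OF lim this]
    obtain n where n: "(LINT p|\<mu>0. indicator (S n) p * ?f p) < (c' - e0) / 2"
      by (auto simp: eventually_sequentially)
    have "enn2real (energy (\<mu> n)) \<le> e0" unfolding e0_def using en_le en0 by (intro enn2real_mono) auto
    hence En: "?E (\<mu> n) < c'" unfolding Ephi_def lint_n using n by (simp add: field_simps)
    define M where "M = enn2real (energy (\<mu> n)) + (measure (\<mu> n) (space (\<mu> n)))\<^sup>2 + 2 * measure (\<mu> n) (space (\<mu> n))"
    have M: "0 \<le> M" by (simp add: M_def)
    \<comment> \<open>The denominator \<open>M + 1\<close> avoids division by zero and leaves the
      final inequality strict.\<close>
    define \<kappa> where "\<kappa> = (c' - ?E (\<mu> n)) / (M + 1)"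
    have \<kappa>: "0 < \<kappa>" using En M by (simp add: \<kappa>_def)
    have "\<kappa> * M < \<kappa> * (M + 1)" using \<kappa> by simp
    also have "\<dots> = c' - ?E (\<mu> n)" using M by (simp add: \<kappa>_def)
    finally have small: "?E (\<mu> n) + \<kappa> * M < c'" by linarith
    have "energy (\<mu> n) < \<infinity>" using en_le en0 by (rule le_less_trans)
    from interior_case[OF F0 _ \<kappa> cont fin sets_n this int_n supp]
    obtain \<delta> where \<delta>: "\<delta> > 0" "\<forall>F\<in>FF A. hausd A F F0 < \<delta> \<longrightarrow> (\<exists>\<nu>\<in>MF A \<rho>0 x t F. ?E \<nu> \<le> ?E (\<mu> n) + \<kappa> * M)"
      unfolding M_def by auto
    show ?thesis using \<delta> small by (meson le_less_trans)
  qed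
  thus "\<exists>\<delta>>0. \<forall>F\<in>FF A. hausd A F F0 < \<delta> \<longrightarrow> EphiF A \<rho>0 x t F < c" using suff by blast
qed

end
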